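(* Let $\mathscr{P}$ be a dominated model with prior $\Pi$ and let $X_1,X_2,\ldots$ be i.i.d.-$P_0$ distributed, where $P_0$ is a probability measure on the sample space (not necessarily an element of $\mathscr{P}$). Assume that $P_0^n\ll P_n^\Pi$ for all $n\geq 1$. For some $N\geq 1$ let $V_1,\ldots,V_N$ be measurable subsets of $\mathscr{P}$. Suppose there exist measurable subsets $B_1,\ldots,B_N$ of $\mathscr{P}$ such that for every $1\leq i\leq N$: $\pi_{P_0}(\mathrm{co}(V_i),B_i)<1$, $\Pi(B_i)>0$, and $\sup_{Q\in B_i}P_0(dP/dQ)<\infty$ for all $P\in V_i$. Then, for any (measurable) $V\subset\bigcup_{1\leq i\leq N}V_i$, \[ \Pi(V\mid X_1,\ldots,X_n)\longrightarrow 0,\qquad P_0\text{-almost surely, as } n\to\infty. \]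
   Context: Setting. $(\mathscr{X},\mathscr{A})$ is a measurable space (the sample space). The model $\mathscr{P}$ is a collection of probability measures on $(\mathscr{X},\mathscr{A})$ dominated by a $\sigma$-finite measure $\mu$, with densities $p=dP/d\mu$; it carries a $\sigma$-algebra $\mathscr{B}$ such that $P\mapsto P(A)$ is measurable for every $A\in\mathscr{A}$ (densities are taken measurable in $(x,P)$, so that the integrals below make sense). The prior $\Pi$ is a probability measure on $(\mathscr{P},\mathscr{B})$. For a measure $P_0$ and a function $f$, $P_0f=\int f\,dP_0$. The prior predictive distributions are $P_n^\Pi(A)=\int P^n(A)\,d\Pi(P)$, $A\in\sigma(X_1,\ldots,X_n)$. The posterior is \[ \Pi(A\mid X_1,\ldots,X_n)=\int_A\prod_{i=1}^n p(X_i)\,d\Pi(P)\Bigm/\int_{\mathscr{P}}\prod_{i=1}^n p(X_i)\,d\Pi(P). \] "$P_0$-almost surely" refers to $P_0^\infty$. $\mathrm{co}(V)$ is the convex hull of $V$ (finite convex combinations). For $\alpha\in[0,1]$ and sets $W,B$ of probability measures, \[ \pi_{P_0}(W,B;\alpha)=\sup_{P\in W}\sup_{Q\in B}P_0\Bigl(\frac{dP}{dQ}\Bigr)^{\alpha},\qquad \pi_{P_0}(W,B)=\inf_{\alpha\in[0,1]}\pi_{P_0}(W,B;\alpha). \] Conventions: $P_0(dP/dQ)^\alpha=\int_{\{p_0>0,\,p>0\}}(p/q)^\alpha\,dP_0$; finiteness of $P_0(dP/dQ)$ includes that $q>0$ $P_0$-almost everywhere on $\{p>0\}$; for $\alpha=0$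 the expression equals $P_0(p>0)$. *)

theory Defs
  imports "HOL-Probability.Probability"
begin

text \<open>
  The sample space with its \<open>\<sigma>\<close>-algebra is carried by the dominating measure \<open>\<mu>\<close>; the
  \<open>\<sigma>\<close>-algebra on the model is \<open>sets prior\<close>.  The densities \<open>p\<close> are a version of
  \<open>dP/d\<mu>\<close> chosen jointly measurable in the sample point and the model point.
\<close>

locale dominated_model =
  sigma_finite_measure \<mu> + prior: prob_space prior
  for \<mu> :: "'a measure"
    and \<P> :: "'a measure set"
    and prior :: "'a measure measure"
    and p :: "'a measure \<Rightarrow> 'a \<Rightarrow> ennreal" +
  assumes space_prior: "space prior = \<P>"
    and prob_space_model: "P \<in> \<P> \<Longrightarrow> prob_space P"
    and sets_model: "P \<in> \<P> \<Longrightarrow> sets P = sets \<mu>"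
    and density_model: "P \<in> \<P> \<Longrightarrow> density \<mu> (p P) = P"
    and measurable_evaluation: "A \<in> sets \<mu> \<Longrightarrow> (\<lambda>P. emeasure P A) \<in> borel_measurable prior"
    and measurable_density: "(\<lambda>(x, P). p P x) \<in> borel_measurable (\<mu> \<Otimes>\<^sub>M prior)"

definition prior_predictive :: "'a measure \<Rightarrow> 'a measure measure \<Rightarrow> nat \<Rightarrow> (nat \<Rightarrow> 'a) measure" where
  "prior_predictive \<mu> prior n =
     measure_of (space (\<Pi>\<^sub>M i\<in>{..<n}. \<mu>)) (sets (\<Pi>\<^sub>M i\<in>{..<n}. \<mu>))
       (\<lambda>A. \<integral>\<^sup>+P. emeasure (\<Pi>\<^sub>M i\<in>{..<n}. P) A \<partial>prior)"

text \<open>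
  The observation \<open>X\<^sub>i\<close> is \<open>x (i - 1)\<close>.  A quotient whose denominator is \<open>0\<close> or \<open>\<infinity>\<close> takes
  the default value of \<^typ>\<open>ennreal\<close> division.
\<close>

definition posterior ::
  "('a measure \<Rightarrow> 'a \<Rightarrow> ennreal) \<Rightarrow> 'a measure measure \<Rightarrow> nat \<Rightarrow> (nat \<Rightarrow> 'a) \<Rightarrow> 'a measure set \<Rightarrow> ennreal" where
  "posterior p prior n x A =
     (\<integral>\<^sup>+P\<in>A. (\<Prod>i<n. p P (x i)) \<partial>prior) / (\<integral>\<^sup>+P. (\<Prod>i<n. p P (x i)) \<partial>prior)"

text \<open>The type of measures is no vector space, so the library's \<open>convex hull\<close> does not apply to it.\<close>

definition convex_mixtures :: "'a measure \<Rightarrow> 'a measure set \<Rightarrow> 'a measure set" where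
  "convex_mixtures \<mu> V =
     {P. sets P = sets \<mu> \<and>
         (\<exists>F w. finite F \<and> F \<subseteq> V \<and> (\<forall>Q\<in>F. 0 \<le> w Q) \<and> (\<Sum>Q\<in>F. w Q) = (1::real) \<and>
            (\<forall>A\<in>sets \<mu>. emeasure P A = (\<Sum>Q\<in>F. ennreal (w Q) * emeasure Q A)))}"

text \<open>Powers on \<open>[0, \<infinity>]\<close> with \<open>t\<^sup>0 = 1\<close> for every \<open>t\<close>, whereas \<open>0 powr 0 = 0\<close> on the reals.\<close>

definition ennreal_powr :: "ennreal \<Rightarrow> real \<Rightarrow> ennreal" where
  "ennreal_powr t \<alpha> =
     (if \<alpha> = 0 then 1 else if t = \<infinity> then \<infinity> else ennreal (enn2real t powr \<alpha>))"

text \<open>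
  \<open>lr_transform \<mu> P0 P Q \<alpha>\<close> is \<open>P\<^sub>0(dP/dQ)\<^sup>\<alpha>\<close>, where \<open>dP/dQ = p/q\<close> for the densities \<open>p, q\<close> with
  respect to \<open>\<mu>\<close>, restricted to \<open>{p > 0}\<close>; if \<open>P\<^sub>0\<close> has density \<open>p\<^sub>0\<close>, the further restriction to
  \<open>{p\<^sub>0 > 0}\<close> only removes a \<open>P\<^sub>0\<close>-null set.  The quotient is \<open>\<infinity>\<close> where \<open>q = 0 < p\<close>, so for \<open>\<alpha> > 0\<close>
  finiteness includes \<open>q > 0\<close> \<open>P\<^sub>0\<close>-almost everywhere on \<open>{p > 0}\<close>.
\<close>

definition lr_transform ::
  "'a measure \<Rightarrow> 'a measure \<Rightarrow> 'a measure \<Rightarrow> 'a measure \<Rightarrow> real \<Rightarrow> ennreal" where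
  "lr_transform \<mu> P0 P Q \<alpha> =
     (\<integral>\<^sup>+x\<in>{x. RN_deriv \<mu> P x > 0}. ennreal_powr (RN_deriv \<mu> P x / RN_deriv \<mu> Q x) \<alpha> \<partial>P0)"

definition separation_at ::
  "'a measure \<Rightarrow> 'a measure \<Rightarrow> 'a measure set \<Rightarrow> 'a measure set \<Rightarrow> real \<Rightarrow> ennreal" where
  "separation_at \<mu> P0 W B \<alpha> = (SUP P\<in>W. SUP Q\<in>B. lr_transform \<mu> P0 P Q \<alpha>)"

definition separation ::
  "'a measure \<Rightarrow> 'a measure \<Rightarrow> 'a measure set \<Rightarrow> 'a measure set \<Rightarrow> ennreal" where
  "separation \<mu> P0 W B = (INF \<alpha>\<in>{0..1}. separation_at \<mu> P0 W B \<alpha>)"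

context dominated_model
begin

lemma measurable_PiM_model:
  "(\<lambda>P. \<Pi>\<^sub>M i\<in>{..<n::nat}. P) \<in> measurable prior (subprob_algebra (\<Pi>\<^sub>M i\<in>{..<n}. \<mu>))"
proof (rule measurable_subprob_algebra_generated
    [OF sets_PiM Int_stable_prod_algebra prod_algebra_sets_into_space])
  fix P assume P: "P \<in> space prior"
  interpret P: prob_space P using P prob_space_model space_prior by auto
  show "subprob_space (\<Pi>\<^sub>M i\<in>{..<n}. P)"
    using P.prob_space_axioms by (intro prob_space_imp_subprob_space prob_space_PiM)
  show "sets (\<Pi>\<^sub>M i\<in>{..<n}. P) = sets (\<Pi>\<^sub>M i\<in>{..<n}. \<mu>)"
    using P sets_model space_prior by (intro sets_PiM_cong) auto
next
  have *: "(\<lambda>P. emeasure (\<Pi>\<^sub>M i\<in>{..<n}. P) (\<Pi>\<^sub>E i\<in>{..<n}. E i)) \<in> borel_measurable prior"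
    if E: "\<And>i. i < n \<Longrightarrow> E i \<in> sets \<mu>" for E
  proof -
    have "(\<lambda>P. \<Prod>i<n. emeasure P (E i)) \<in> borel_measurable prior"
      using E measurable_evaluation by (intro borel_measurable_prod_ennreal) auto
    moreover have "emeasure (\<Pi>\<^sub>M i\<in>{..<n}. P) (\<Pi>\<^sub>E i\<in>{..<n}. E i) = (\<Prod>i<n. emeasure P (E i))"
      if P: "P \<in> space prior" for P
    proof -
      interpret P: prob_space P using P prob_space_model space_prior by auto
      interpret prd: product_sigma_finite "\<lambda>_::nat. P"
        by (simp add: product_sigma_finite_def P.sigma_finite_measure_axioms)
      show ?thesis using P E sets_model space_prior by (intro prd.emeasure_PiM) auto
    qed
    ultimately show ?thesis by (simp cong: measurable_cong)
  qed
  show "(\<lambda>P. emeasure (\<Pi>\<^sub>M i\<in>{..<n}. P) A) \<in> borel_measurable prior"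
    if "A \<in> prod_algebra {..<n} (\<lambda>_. \<mu>)" for A
    using that * by (auto simp: prod_algebra_eq_finite)
  show "(\<lambda>P. emeasure (\<Pi>\<^sub>M i\<in>{..<n}. P) (\<Pi>\<^sub>E i\<in>{..<n}. space \<mu>)) \<in> borel_measurable prior"
    using * by auto
qed

lemma sets_prior_predictive: "sets (prior_predictive \<mu> prior n) = sets (\<Pi>\<^sub>M i\<in>{..<n}. \<mu>)"
  by (simp add: prior_predictive_def)

text \<open>The set function in the definition of the prior predictive is indeed a measure.\<close>

lemma emeasure_prior_predictive:
  assumes "A \<in> sets (\<Pi>\<^sub>M i\<in>{..<n}. \<mu>)"
  shows "emeasure (prior_predictive \<mu> prior n) A = (\<integral>\<^sup>+P. emeasure (\<Pi>\<^sub>M i\<in>{..<n}. P) A \<partial>prior)"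
proof (rule emeasure_measure_of[OF prior_predictive_def])
  let ?N = "\<Pi>\<^sub>M i\<in>{..<n}. \<mu>"
  have meas: "(\<lambda>P. emeasure (\<Pi>\<^sub>M i\<in>{..<n}. P) B) \<in> borel_measurable prior" if "B \<in> sets ?N" for B
    using measurable_emeasure_kernel[OF measurable_PiM_model that] .
  have sets: "sets (\<Pi>\<^sub>M i\<in>{..<n}. P) = sets ?N" if "P \<in> space prior" for P
    using that sets_model space_prior by (intro sets_PiM_cong) auto
  show "sets ?N \<subseteq> Pow (space ?N)" by (rule sets.space_closed)
  show "A \<in> sets (prior_predictive \<mu> prior n)"
    using assms by (simp add: sets_prior_predictive)
  show "positive (sets (prior_predictive \<mu> prior n)) (\<lambda>A. \<integral>\<^sup>+P. emeasure (\<Pi>\<^sub>M i\<in>{..<n}. P) A \<partial>prior)"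
    by (simp add: positive_def)
  show "countably_additive (sets (prior_predictive \<mu> prior n))
      (\<lambda>A. \<integral>\<^sup>+P. emeasure (\<Pi>\<^sub>M i\<in>{..<n}. P) A \<partial>prior)"
    unfolding countably_additive_def sets_prior_predictive
  proof (intro allI impI)
    fix B :: "nat \<Rightarrow> (nat \<Rightarrow> 'a) set"
    assume B: "range B \<subseteq> sets ?N" "disjoint_family B"
    have "(\<Sum>k. \<integral>\<^sup>+P. emeasure (\<Pi>\<^sub>M i\<in>{..<n}. P) (B k) \<partial>prior)
        = (\<integral>\<^sup>+P. (\<Sum>k. emeasure (\<Pi>\<^sub>M i\<in>{..<n}. P) (B k)) \<partial>prior)"
      using B by (intro nn_integral_suminf[symmetric] meas) auto
    also have "\<dots> = (\<integral>\<^sup>+P. emeasure (\<Pi>\<^sub>M i\<in>{..<n}. P) (\<Union>k. B k) \<partial>prior)"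
      using B sets by (intro nn_integral_cong suminf_emeasure) auto
    finally show "(\<Sum>k. \<integral>\<^sup>+P. emeasure (\<Pi>\<^sub>M i\<in>{..<n}. P) (B k) \<partial>prior)
        = (\<integral>\<^sup>+P. emeasure (\<Pi>\<^sub>M i\<in>{..<n}. P) (\<Union>k. B k) \<partial>prior)" .
  qed
qed

end

end

(* Fix i and an exponent a in [0,1] with P_0(dP/dQ)^a <= rho < 1 for all P in co(V_i), Q in B_i.  With
   L_n the likelihood, the posterior of V_i is at most 1, so it is bounded by the a-th power of the
   ratio of the integrals of L_n over V_i and over B_i.  Convexity of t^(-a) (Jensen) replaces the
   denominator by L_n(Q) for a single Q in B_i.  Peeling off the observations one by one, each
   contributes a factor P_0(m/q)^a in which m is the density of a mixture over V_i (weighted by the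
   likelihood of the observations already removed), so the expectation is O(rho^n): it is summable,
   and the posterior tends to 0 almost surely.  The mixtures are integrals rather than finite convex
   combinations; Maurey's empirical method approximates them by uniform averages of finitely many
   densities, and Fatou's lemma carries the bound rho over. *)

theory Submission
  imports Defs
begin

section \<open>Powers on the extended nonnegative reals\<close>

text \<open>With the value \<open>0\<close> at \<open>0\<close>, also for \<open>\<alpha> = 0\<close>, the power accounts for the restriction to \<open>{p > 0}\<close>
  in \<^const>\<open>lr_transform\<close>, and it is multiplicative on all of \<open>[0, \<infinity>]\<close>.\<close>

definition powr0 :: "real \<Rightarrow> ennreal \<Rightarrow> ennreal" where
  "powr0 \<alpha> t = (if t = 0 then 0 else ennreal_powr t \<alpha>)"

lemma powr0_0 [simp]: "powr0 \<alpha> 0 = 0"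
  by (simp add: powr0_def)

lemma powr0_top: "powr0 \<alpha> \<top> = (if \<alpha> = 0 then 1 else \<top>)"
  by (simp add: powr0_def ennreal_powr_def)

lemma powr0_ennreal: "0 \<le> r \<Longrightarrow> powr0 \<alpha> (ennreal r) = ennreal (r powr \<alpha>)"
  by (auto simp: powr0_def ennreal_powr_def)

lemma powr0_eq: "powr0 \<alpha> t = (if t = \<top> then (if \<alpha> = 0 then 1 else \<top>) else ennreal (enn2real t powr \<alpha>))"
  by (cases t) (auto simp: powr0_top powr0_ennreal)

lemma powr0_less_top: "t < \<top> \<Longrightarrow> powr0 \<alpha> t < \<top>"
  by (simp add: powr0_eq)

lemma measurable_powr0 [measurable]: "powr0 \<alpha> \<in> borel_measurable borel"
  unfolding powr0_eq [abs_def] by measurable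

lemma powr0_mono:
  assumes "0 \<le> \<alpha>" "s \<le> t"
  shows "powr0 \<alpha> s \<le> powr0 \<alpha> t"
proof (cases s; cases t)
  fix r u assume "0 \<le> r" "s = ennreal r" "0 \<le> u" "t = ennreal u"
  then show ?thesis using assms by (auto simp: powr0_ennreal intro!: ennreal_leI powr_mono2)
next
  fix r assume "0 \<le> r" "s = ennreal r" "t = \<top>"
  then show ?thesis using assms by (auto simp: powr0_ennreal powr0_top)
qed (use assms in \<open>auto simp: powr0_ennreal powr0_top top_unique\<close>)

lemma powr0_mult:
  assumes "0 \<le> \<alpha>"
  shows "powr0 \<alpha> (s * t) = powr0 \<alpha> s * powr0 \<alpha> t"
proof (cases "s = 0 \<or> t = 0")
  case False
  then show ?thesis using assms
    by (cases s; cases t)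
       (auto simp: powr0_ennreal powr0_top ennreal_mult_top ennreal_top_mult powr_mult ennreal_mult
             simp flip: ennreal_mult)
qed auto

lemma le_powr0:
  assumes "0 \<le> \<alpha>" "\<alpha> \<le> 1" "t \<le> 1"
  shows "t \<le> powr0 \<alpha> t"
proof (cases t)
  case (real r)
  then have "r \<le> 1" using assms by auto
  have "r powr 1 \<le> r powr \<alpha>" using real \<open>r \<le> 1\<close> assms by (intro powr_mono') auto
  then show ?thesis using real by (auto simp: powr0_ennreal)
qed (use assms in \<open>auto simp: top_unique\<close>)

text \<open>Only this half of continuity survives. For \<open>\<alpha> = 0\<close> the power jumps
  from 1 to 0 at \<open>t = 0\<close>, and for \<open>c = \<top>\<close> the product jumps where the
  limit of the power is 0. In both cases the left side is 0; for positive finite \<open>t\<close>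
  there is true convergence, even with \<open>c = \<top>\<close>.\<close>

lemma powr0_lsc:
  assumes "u \<longlonglongrightarrow> t" "t < \<top>"
  shows "powr0 \<alpha> t * c \<le> liminf (\<lambda>n. powr0 \<alpha> (u n) * c)"
proof (cases "t = 0")
  case False
  obtain r where r: "0 < r" "t = ennreal r"
    using assms False by (cases t) auto
  have ev: "\<forall>\<^sub>F n in sequentially. u n < \<top>"
    using assms order_tendstoD(2) by blast
  have "u \<longlonglongrightarrow> ennreal r" using assms(1) unfolding r(2) .
  then have "(\<lambda>n. enn2real (u n)) \<longlonglongrightarrow> r"
    by (rule tendsto_enn2real) (use r in simp)
  then have "(\<lambda>n. ennreal (enn2real (u n) powr \<alpha>)) \<longlonglongrightarrow> ennreal (r powr \<alpha>)"
    using r by (intro tendsto_ennrealI tendsto_powr tendsto_const) auto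
  then have "(\<lambda>n. powr0 \<alpha> (u n)) \<longlonglongrightarrow> ennreal (r powr \<alpha>)"
    by (rule Lim_transform_eventually) (use ev in \<open>auto elim!: eventually_mono simp: powr0_eq\<close>)
  then have "(\<lambda>n. powr0 \<alpha> (u n) * c) \<longlonglongrightarrow> ennreal (r powr \<alpha>) * c"
    using r by (intro tendsto_mult_ennreal tendsto_const) auto
  then show ?thesis
    using r by (simp add: lim_imp_Liminf powr0_ennreal)
qed auto

text \<open>The tangent to the convex function \<open>t \<mapsto> t powr - \<alpha>\<close> at \<open>c\<close>, with the subtracted term moved
  to the other side.\<close>

lemma powr0_inverse_tangent:
  assumes "0 \<le> \<alpha>" "\<alpha> \<le> 1" "0 < c" "t < \<top>"
  shows "ennreal (1 + \<alpha>) * powr0 \<alpha> (inverse (ennreal c))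
    \<le> powr0 \<alpha> (inverse t) + ennreal (\<alpha> * c powr - \<alpha> / c) * t"
proof -
  obtain r where r: "0 \<le> r" "t = ennreal r" using assms by (cases t) auto
  have c: "powr0 \<alpha> (inverse (ennreal c)) = ennreal (c powr - \<alpha>)"
    using assms by (simp add: inverse_ennreal powr0_ennreal powr_minus inverse_powr)
  show ?thesis
  proof (cases "r = 0")
    \<comment> \<open>Here \<open>inverse t = \<top>\<close>. The right side is infinite if \<alpha>
      > 0, and both sides equal 1 if \<alpha> = 0.\<close>
    case True
    then show ?thesis using r assms c
      by (cases "\<alpha> = 0") (auto simp: powr0_top)
  next
    case False
    then have "0 < r" using r by simp
    define s where "s = r / c"
    have "0 < s" "r = s * c" using \<open>0 < r\<close> assms by (auto simp: s_def)
    \<comment> \<open>After rescaling by \<open>c\<close> the tangent point is 1. The bound combines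
      ln s \<le> s - 1 with exp z \<ge> 1 + z.\<close>
    have "1 - \<alpha> * (s - 1) \<le> 1 - \<alpha> * ln s"
      using \<open>0 < s\<close> assms ln_le_minus_one[of s] by (simp add: mult_left_mono)
    also have "\<dots> \<le> exp (- \<alpha> * ln s)"
      using exp_ge_add_one_self[of "- \<alpha> * ln s"] by simp
    also have "\<dots> = s powr - \<alpha>" using \<open>0 < s\<close> by (simp add: powr_def)
    finally have "(1 + \<alpha>) * c powr - \<alpha> \<le> (s powr - \<alpha> + \<alpha> * s) * c powr - \<alpha>"
      by (intro mult_right_mono) (auto simp: algebra_simps)
    also have "\<dots> = r powr - \<alpha> + \<alpha> * c powr - \<alpha> / c * r"
      using \<open>r = s * c\<close> \<open>0 < s\<close> assms by (simp add: powr_mult algebra_simps)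
    finally have "ennreal ((1 + \<alpha>) * c powr - \<alpha>) \<le> ennreal (r powr - \<alpha> + \<alpha> * c powr - \<alpha> / c * r)"
      by (rule ennreal_leI)
    moreover have "powr0 \<alpha> (inverse t) = ennreal (r powr - \<alpha>)"
      using r \<open>0 < r\<close> by (simp add: inverse_ennreal powr0_ennreal powr_minus inverse_powr)
    ultimately show ?thesis
      using assms c r by (simp add: ennreal_plus ennreal_mult flip: ennreal_mult'')
  qed
qed

text \<open>Integrate the tangent inequality at the mean \<open>c\<close>: the linear term
  contributes exactly \<alpha> times the power at \<open>c\<close>, which cancels. Values 0 and
  \<top> of \<open>f\<close> are allowed, so the inverse may be infinite; if the mean itself is
  infinite, the left side is 0.\<close>

lemma (in prob_space) powr0_inverse_jensen:
  assumes [measurable]: "f \<in> borel_measurable M" and \<alpha>: "0 \<le> \<alpha>" "\<alpha> \<le> 1"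
  shows "powr0 \<alpha> (inverse (\<integral>\<^sup>+x. f x \<partial>M)) \<le> (\<integral>\<^sup>+x. powr0 \<alpha> (inverse (f x)) \<partial>M)"
proof (cases "\<integral>\<^sup>+x. f x \<partial>M")
  case (real c)
  show ?thesis
  proof (cases "c = 0")
    \<comment> \<open>A zero mean forces \<open>f\<close> to vanish almost everywhere, and both
      sides become \<open>powr0 \<alpha> \<top>\<close>.\<close>
    case True
    then have "AE x in M. f x = 0" using real by (simp add: nn_integral_0_iff_AE)
    then have "(\<integral>\<^sup>+x. powr0 \<alpha> (inverse (f x)) \<partial>M) = (\<integral>\<^sup>+x. powr0 \<alpha> \<top> \<partial>M)"
      by (intro nn_integral_cong_AE) auto
    then show ?thesis using True real by (simp add: emeasure_space_1)
  next
    case False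
    then have c: "0 < c" using real by simp
    define d where "d = powr0 \<alpha> (inverse (ennreal c))"
    have fin: "AE x in M. f x < \<top>"
      using nn_integral_PInf_AE[of f M] real by (auto simp: top.not_eq_extremum)
    have d: "d = ennreal (c powr - \<alpha>)"
      using c by (simp add: d_def inverse_ennreal powr0_ennreal powr_minus inverse_powr)
    \<comment> \<open>Written as a sum so that the finite term \<open>ennreal \<alpha> * d\<close>
      can be cancelled from both sides at the end, without subtraction in
      \<open>ennreal\<close>.\<close>
    have "d + ennreal \<alpha> * d = ennreal (1 + \<alpha>) * d"
      using \<alpha> by (simp add: distrib_right)
    also have "\<dots> = (\<integral>\<^sup>+x. ennreal (1 + \<alpha>) * d \<partial>M)" by (simp add: emeasure_space_1)
    also have "\<dots> \<le> (\<integral>\<^sup>+x. powr0 \<alpha> (inverse (f x)) + ennreal (\<alpha> * c powr - \<alpha> / c) * f x \<partial>M)"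
      unfolding d_def
      by (intro nn_integral_mono_AE) (use fin powr0_inverse_tangent[OF \<alpha> c] in auto)
    also have "\<dots> = (\<integral>\<^sup>+x. powr0 \<alpha> (inverse (f x)) \<partial>M) + ennreal (\<alpha> * c powr - \<alpha> / c) * ennreal c"
      by (subst nn_integral_add) (auto simp: nn_integral_cmult real)
    also have "ennreal (\<alpha> * c powr - \<alpha> / c) * ennreal c = ennreal \<alpha> * d"
      using c \<alpha> d by (simp flip: ennreal_mult)
    finally have "d \<le> (\<integral>\<^sup>+x. powr0 \<alpha> (inverse (f x)) \<partial>M)"
      using d \<alpha> by (simp add: ennreal_mult_eq_top_iff add.commute)
    then show ?thesis using real d_def by simp
  qed
qed simp

section \<open>Approximation of mixtures by finite averages\<close>

lemma square_le_square_of_abs_le: "\<bar>a\<bar> \<le> C \<Longrightarrow> a\<^sup>2 \<le> C\<^sup>2" for a C :: real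
  using power_mono[of "\<bar>a\<bar>" C 2] by simp

lemma (in prob_space) integrable_bounded:
  fixes f :: "'a \<Rightarrow> real"
  assumes "f \<in> borel_measurable M" "\<And>x. x \<in> space M \<Longrightarrow> \<bar>f x\<bar> \<le> C"
  shows "integrable M f"
  using assms by (intro integrable_const_bound[of _ C]) auto

lemma (in prob_space) abs_integral_le:
  fixes f :: "'a \<Rightarrow> real"
  assumes "f \<in> borel_measurable M" "\<And>x. x \<in> space M \<Longrightarrow> \<bar>f x\<bar> \<le> C"
  shows "\<bar>\<integral>x. f x \<partial>M\<bar> \<le> C"
proof -
  have "\<bar>\<integral>x. f x \<partial>M\<bar> \<le> (\<integral>x. \<bar>f x\<bar> \<partial>M)" by (rule integral_abs_bound)
  also have "\<dots> \<le> C"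
    using integrable_bounded[OF assms] assms by (intro integral_le_const) auto
  finally show ?thesis .
qed

text \<open>The greedy step of Maurey's empirical method: the cross term vanishes in the mean over \<open>y\<close>.\<close>

lemma (in pair_prob_space) maurey_step:
  fixes f :: "'a \<Rightarrow> 'b \<Rightarrow> real"
  assumes f [measurable]: "(\<lambda>(x, y). f x y) \<in> borel_measurable (M1 \<Otimes>\<^sub>M M2)"
    and f_bound: "\<And>x y. x \<in> space M1 \<Longrightarrow> y \<in> space M2 \<Longrightarrow> \<bar>f x y\<bar> \<le> C"
    and s [measurable]: "s \<in> borel_measurable M1"
    and s_bound: "\<And>x. x \<in> space M1 \<Longrightarrow> \<bar>s x\<bar> \<le> D"
    and V: "AE y in M2. y \<in> V"
  shows "\<exists>y\<in>V \<inter> space M2. (\<integral>x. (s x + (f x y - (\<integral>z. f x z \<partial>M2)))\<^sup>2 \<partial>M1) \<le> (\<integral>x. (s x)\<^sup>2 \<partial>M1) + C\<^sup>2"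
proof (rule ccontr)
  define m where "m x = (\<integral>z. f x z \<partial>M2)" for x
  have [measurable]: "m \<in> borel_measurable M1" unfolding m_def by measurable
  have fx [measurable]: "f x \<in> borel_measurable M2" if "x \<in> space M1" for x
    using measurable_compose[OF measurable_Pair1'[OF that] f] by simp
  have f2_bound: "\<bar>(f x y)\<^sup>2\<bar> \<le> C\<^sup>2" if "x \<in> space M1" "y \<in> space M2" for x y
    using square_le_square_of_abs_le[OF f_bound[OF that]] by simp
  have int_f: "integrable M2 (f x)" if "x \<in> space M1" for x
    using that by (intro M2.integrable_bounded[of _ C] fx f_bound)
  have int_f2: "integrable M2 (\<lambda>y. (f x y)\<^sup>2)" if "x \<in> space M1" for x
    using that by (intro M2.integrable_bounded[of _ "C\<^sup>2"] f2_bound) measurable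
  have m_bound: "\<bar>m x\<bar> \<le> C" if "x \<in> space M1" for x
    unfolding m_def using that by (intro M2.abs_integral_le fx f_bound)
  have s2_bound: "\<bar>(s x)\<^sup>2\<bar> \<le> D\<^sup>2" if "x \<in> space M1" for x
    using square_le_square_of_abs_le[OF s_bound[OF that]] by simp
  have int_s2: "integrable M1 (\<lambda>x. (s x)\<^sup>2)"
    by (intro M1.integrable_bounded[of _ "D\<^sup>2"] s2_bound) measurable
  define F where "F x y = (s x + (f x y - m x))\<^sup>2" for x y
  have F [measurable]: "(\<lambda>(x, y). F x y) \<in> borel_measurable (M1 \<Otimes>\<^sub>M M2)"
    unfolding F_def by measurable
  have F_bound: "\<bar>F x y\<bar> \<le> (D + 2 * C)\<^sup>2" if "x \<in> space M1" "y \<in> space M2" for x y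
  proof -
    have "\<bar>s x + (f x y - m x)\<bar> \<le> D + 2 * C"
      using f_bound[OF that] m_bound[OF that(1)] s_bound[OF that(1)] by linarith
    then show ?thesis unfolding F_def abs_power2 by (rule square_le_square_of_abs_le)
  qed
  have int_F: "integrable (M1 \<Otimes>\<^sub>M M2) (\<lambda>(x, y). F x y)"
    using F_bound F by (intro P.integrable_bounded[of _ "(D + 2 * C)\<^sup>2"]) (auto simp: space_pair_measure)
  \<comment> \<open>Since \<open>m x\<close> is the mean of \<open>f x\<close>, the left side is
    \<open>(s x)\<^sup>2\<close> plus the variance of \<open>f x\<close>, and the variance is at
    most the second moment.\<close>
  have inner: "(\<integral>y. F x y \<partial>M2) \<le> (s x)\<^sup>2 + C\<^sup>2" if x: "x \<in> space M1" for x
  proof -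
    have "F x y = (s x - m x)\<^sup>2 + (2 * (s x - m x) * f x y + (f x y)\<^sup>2)" for y
      by (simp add: F_def power2_eq_square algebra_simps)
    then have "(\<integral>y. F x y \<partial>M2) = (s x - m x)\<^sup>2 + (2 * (s x - m x) * m x + (\<integral>y. (f x y)\<^sup>2 \<partial>M2))"
      using x int_f int_f2 by (simp add: m_def M2.prob_space)
    also have "\<dots> = (s x)\<^sup>2 - (m x)\<^sup>2 + (\<integral>y. (f x y)\<^sup>2 \<partial>M2)"
      by (simp add: power2_eq_square algebra_simps)
    also have "\<dots> \<le> (s x)\<^sup>2 + (\<integral>y. (f x y)\<^sup>2 \<partial>M2)" by simp
    also have "(\<integral>y. (f x y)\<^sup>2 \<partial>M2) \<le> C\<^sup>2"
      using M2.abs_integral_le[OF borel_measurable_power[OF fx[OF x]] f2_bound[OF x]] by simp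
    finally show ?thesis by simp
  qed
  \<comment> \<open>If every point of \<open>V\<close> violated the bound, so would the average over
    \<open>y\<close>; Fubini and \<open>inner\<close> contradict this.\<close>
  assume "\<not> ?thesis"
  then have neg: "(\<integral>x. (s x)\<^sup>2 \<partial>M1) + C\<^sup>2 < (\<integral>x. F x y \<partial>M1)" if "y \<in> V" "y \<in> space M2" for y
    using that by (auto simp: F_def m_def not_le)
  have "(\<integral>x. (s x)\<^sup>2 \<partial>M1) + C\<^sup>2 < (\<integral>y. (\<integral>x. F x y \<partial>M1) \<partial>M2)"
    using V neg by (intro M2.expectation_greater integrable_snd int_F) (auto elim!: AE_mp)
  also have "\<dots> = (\<integral>x. (\<integral>y. F x y \<partial>M2) \<partial>M1)"
    by (rule Fubini_integral[OF int_F])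
  also have "\<dots> \<le> (\<integral>x. (s x)\<^sup>2 + C\<^sup>2 \<partial>M1)"
  proof (rule integral_mono)
    show "integrable M1 (\<lambda>x. (s x)\<^sup>2 + C\<^sup>2)"
      using int_s2 by simp
  qed (use inner integrable_fst'[OF int_F] in auto)
  also have "\<dots> = (\<integral>x. (s x)\<^sup>2 \<partial>M1) + C\<^sup>2"
    using int_s2 by (simp add: M1.prob_space)
  finally show False by simp
qed

text \<open>The points are chosen greedily: each new one adds at most \<open>C\<^sup>2\<close> to
  the integral of the squared sum of deviations, just as variances of independent draws would add.
  The linear growth in \<open>k\<close> becomes decay of order 1/k for averages.\<close>

lemma (in pair_prob_space) maurey_L2:
  fixes f :: "'a \<Rightarrow> 'b \<Rightarrow> real"
  assumes f [measurable]: "(\<lambda>(x, y). f x y) \<in> borel_measurable (M1 \<Otimes>\<^sub>M M2)"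
    and f_bound: "\<And>x y. x \<in> space M1 \<Longrightarrow> y \<in> space M2 \<Longrightarrow> \<bar>f x y\<bar> \<le> C"
    and V: "AE y in M2. y \<in> V"
  shows "\<exists>Y. (\<forall>j<k. Y j \<in> V \<inter> space M2) \<and>
    (\<integral>x. (\<Sum>j<k. f x (Y j) - (\<integral>z. f x z \<partial>M2))\<^sup>2 \<partial>M1) \<le> real k * C\<^sup>2"
proof (induction k)
  case (Suc k)
  then obtain Y where Y: "\<And>j. j < k \<Longrightarrow> Y j \<in> V \<inter> space M2"
    and le: "(\<integral>x. (\<Sum>j<k. f x (Y j) - (\<integral>z. f x z \<partial>M2))\<^sup>2 \<partial>M1) \<le> real k * C\<^sup>2"
    by blast
  define m where "m x = (\<integral>z. f x z \<partial>M2)" for x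
  have [measurable]: "m \<in> borel_measurable M1" unfolding m_def by measurable
  have fY [measurable]: "(\<lambda>x. f x (Y j)) \<in> borel_measurable M1" if "j < k" for j
    using Y[OF that] measurable_compose[OF measurable_Pair2' f, of "Y j"] by simp
  have fx: "f x \<in> borel_measurable M2" if "x \<in> space M1" for x
    using measurable_compose[OF measurable_Pair1'[OF that] f] by simp
  have m_bound: "\<bar>m x\<bar> \<le> C" if "x \<in> space M1" for x
    unfolding m_def using that by (intro M2.abs_integral_le fx f_bound)
  have "\<exists>y\<in>V \<inter> space M2. (\<integral>x. ((\<Sum>j<k. f x (Y j) - m x) + (f x y - (\<integral>z. f x z \<partial>M2)))\<^sup>2 \<partial>M1)
      \<le> (\<integral>x. (\<Sum>j<k. f x (Y j) - m x)\<^sup>2 \<partial>M1) + C\<^sup>2"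
  proof (rule maurey_step[OF f f_bound _ _ V])
    show "(\<lambda>x. \<Sum>j<k. f x (Y j) - m x) \<in> borel_measurable M1"
      by (intro borel_measurable_sum borel_measurable_diff fY) auto
    fix x assume x: "x \<in> space M1"
    have "\<bar>m x\<bar> \<le> C" by (rule m_bound[OF x])
    moreover have "\<bar>f x (Y j)\<bar> \<le> C" if "j < k" for j using x Y[OF that] f_bound by auto
    ultimately have "\<bar>f x (Y j) - m x\<bar> \<le> C + C" if "j < k" for j
      using that by (smt (verit))
    \<comment> \<open>A crude bound suffices: in \<open>maurey_step\<close> the constant
      \<open>D\<close> only secures integrability and does not enter the conclusion.\<close>
    then show "\<bar>\<Sum>j<k. f x (Y j) - m x\<bar> \<le> (\<Sum>j<k. C + C)"
      by (intro order_trans[OF sum_abs] sum_mono) auto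
  qed auto
  then obtain y where y: "y \<in> V \<inter> space M2" and
    step: "(\<integral>x. ((\<Sum>j<k. f x (Y j) - m x) + (f x y - m x))\<^sup>2 \<partial>M1)
      \<le> (\<integral>x. (\<Sum>j<k. f x (Y j) - m x)\<^sup>2 \<partial>M1) + C\<^sup>2"
    by (auto simp: m_def)
  have "(\<Sum>j<k. f x ((Y(k := y)) j) - m x) = (\<Sum>j<k. f x (Y j) - m x)" for x
    by (intro sum.cong) auto
  then have "(\<integral>x. (\<Sum>j<Suc k. f x ((Y(k := y)) j) - m x)\<^sup>2 \<partial>M1) \<le> real (Suc k) * C\<^sup>2"
    using step le by (simp add: m_def algebra_simps)
  moreover have "\<forall>j<Suc k. (Y(k := y)) j \<in> V \<inter> space M2"
    using Y y by (auto simp: less_Suc_eq)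
  ultimately show ?case unfolding m_def by blast
qed auto

text \<open>By \<open>maurey_L2\<close> the averages of \<open>k\<close> points converge to the mean
  in mean square, so a subsequence converges almost everywhere. The points for different sample
  sizes are unrelated to each other; Fatou's lemma needs no more.\<close>

lemma (in pair_prob_space) empirical_means_converge_AE:
  fixes f :: "'a \<Rightarrow> 'b \<Rightarrow> real"
  assumes f [measurable]: "(\<lambda>(x, y). f x y) \<in> borel_measurable (M1 \<Otimes>\<^sub>M M2)"
    and f_bound: "\<And>x y. x \<in> space M1 \<Longrightarrow> y \<in> space M2 \<Longrightarrow> \<bar>f x y\<bar> \<le> C"
    and V: "AE y in M2. y \<in> V"
  obtains Y :: "nat \<Rightarrow> nat \<Rightarrow> 'b" and r :: "nat \<Rightarrow> nat"
  where "\<And>n. 0 < r n" "\<And>n j. j < r n \<Longrightarrow> Y n j \<in> V \<inter> space M2"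
    "AE x in M1. (\<lambda>n. (\<Sum>j<r n. f x (Y n j)) / r n) \<longlonglongrightarrow> (\<integral>z. f x z \<partial>M2)"
proof -
  define m where "m x = (\<integral>z. f x z \<partial>M2)" for x
  have [measurable]: "m \<in> borel_measurable M1" unfolding m_def by measurable
  have "\<forall>k. \<exists>Y. (\<forall>j<k. Y j \<in> V \<inter> space M2) \<and> (\<integral>x. (\<Sum>j<k. f x (Y j) - m x)\<^sup>2 \<partial>M1) \<le> real k * C\<^sup>2"
    unfolding m_def using maurey_L2[OF f f_bound V] by (intro allI)
  from choice[OF this] obtain Y where
    Y: "\<And>k j. j < k \<Longrightarrow> Y k j \<in> V \<inter> space M2"
    and le: "\<And>k. (\<integral>x. (\<Sum>j<k. f x (Y k j) - m x)\<^sup>2 \<partial>M1) \<le> real k * C\<^sup>2"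
    by blast
  have fY [measurable]: "(\<lambda>x. f x (Y k j)) \<in> borel_measurable M1" if "j < k" for j k
    using Y[OF that] measurable_compose[OF measurable_Pair2' f, of "Y k j"] by simp
  have fx: "f x \<in> borel_measurable M2" if "x \<in> space M1" for x
    using measurable_compose[OF measurable_Pair1'[OF that] f] by simp
  have m_bound: "\<bar>m x\<bar> \<le> C" if "x \<in> space M1" for x
    unfolding m_def using that by (intro M2.abs_integral_le fx f_bound)
  \<comment> \<open>Squared deviations turn mean-square convergence into L1 convergence, and
    \<open>Suc k\<close> avoids the empty average.\<close>
  define u where "u k x = ((\<Sum>j<Suc k. f x (Y (Suc k) j)) / Suc k - m x)\<^sup>2" for k x
  have u_eq: "u k x = (\<Sum>j<Suc k. f x (Y (Suc k) j) - m x)\<^sup>2 / (real (Suc k))\<^sup>2" for k x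
    unfolding u_def sum_subtractf power_divide[symmetric]
    by (intro arg_cong[where f = "\<lambda>z. z\<^sup>2"]) (simp add: diff_divide_distrib del: sum.lessThan_Suc of_nat_Suc)
  have u_meas: "u k \<in> borel_measurable M1" for k
    unfolding u_def
    by (intro borel_measurable_power borel_measurable_diff borel_measurable_divide borel_measurable_sum fY) auto
  have u_bound: "\<bar>u k x\<bar> \<le> (2 * C)\<^sup>2" if x: "x \<in> space M1" for k x
  proof -
    have "\<bar>f x (Y (Suc k) j)\<bar> \<le> C" if "j < Suc k" for j using x Y[OF that] f_bound by auto
    then have "\<bar>\<Sum>j<Suc k. f x (Y (Suc k) j)\<bar> \<le> (\<Sum>j<Suc k. C)"
      by (intro order_trans[OF sum_abs] sum_mono) auto
    then have "\<bar>(\<Sum>j<Suc k. f x (Y (Suc k) j)) / Suc k\<bar> \<le> C"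
      by (simp add: abs_divide field_simps del: sum.lessThan_Suc)
    then have "\<bar>(\<Sum>j<Suc k. f x (Y (Suc k) j)) / Suc k - m x\<bar> \<le> 2 * C"
      using m_bound[OF x] by linarith
    then show ?thesis unfolding u_def abs_power2 by (rule square_le_square_of_abs_le)
  qed
  have "integrable M1 (u k)" for k
    by (intro M1.integrable_bounded[of _ "(2 * C)\<^sup>2"] u_bound u_meas)
  moreover have "(\<lambda>k. (\<integral>x. norm (u k x) \<partial>M1)) \<longlonglongrightarrow> 0"
  proof (rule tendsto_sandwich[where f = "\<lambda>_. 0" and h = "\<lambda>k. C\<^sup>2 / real (Suc k)"])
    have "(\<integral>x. norm (u k x) \<partial>M1) \<le> C\<^sup>2 / Suc k" for k
    proof -
      have "(\<integral>x. norm (u k x) \<partial>M1) = (\<integral>x. (\<Sum>j<Suc k. f x (Y (Suc k) j) - m x)\<^sup>2 \<partial>M1) / (real (Suc k))\<^sup>2"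
        by (simp add: u_eq del: sum.lessThan_Suc)
      also have "\<dots> \<le> real (Suc k) * C\<^sup>2 / (real (Suc k))\<^sup>2"
        by (intro divide_right_mono le) auto
      also have "\<dots> = C\<^sup>2 / Suc k"
        unfolding power2_eq_square[of "real (Suc k)"] mult_divide_mult_cancel_left_if by simp
      finally show ?thesis .
    qed
    then show "\<forall>\<^sub>F k in sequentially. (\<integral>x. norm (u k x) \<partial>M1) \<le> C\<^sup>2 / Suc k"
      by (rule always_eventually[OF allI])
    show "(\<lambda>k. C\<^sup>2 / real (Suc k)) \<longlonglongrightarrow> 0"
      by (intro LIMSEQ_Suc lim_const_over_n)
  qed auto
  ultimately obtain r where "AE x in M1. (\<lambda>n. u (r n) x) \<longlonglongrightarrow> 0"
    using tendsto_L1_AE_subseq[of M1 u] by blast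
  then have "AE x in M1. (\<lambda>n. (\<Sum>j<Suc (r n). f x (Y (Suc (r n)) j)) / Suc (r n)) \<longlonglongrightarrow> m x"
  proof eventually_elim
    case (elim x)
    then have "(\<lambda>n. sqrt (u (r n) x)) \<longlonglongrightarrow> sqrt 0" by (rule tendsto_real_sqrt)
    then have "(\<lambda>n. (\<Sum>j<Suc (r n). f x (Y (Suc (r n)) j)) / Suc (r n) - m x) \<longlonglongrightarrow> 0"
      by (simp add: u_def tendsto_rabs_zero_iff del: sum.lessThan_Suc)
    then show ?case by (simp add: LIM_zero_iff del: sum.lessThan_Suc)
  qed
  then show ?thesis
    using Y by (intro that[of "\<lambda>n. Suc (r n)" "\<lambda>n. Y (Suc (r n))"]) (auto simp: m_def)
qed

section \<open>Likelihood ratios of mixtures\<close>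

text \<open>Fatou's lemma with \<open>powr0_lsc\<close> applied pointwise. The factor
  \<open>c\<close> stays separate because an inverse density may be infinite. It serves two limits:
  that of finite averages and that of rising truncation levels.\<close>

lemma powr0_fatou:
  assumes [measurable]: "\<And>n. u n \<in> borel_measurable M" "c \<in> borel_measurable M" "t \<in> borel_measurable M"
    and \<alpha>: "0 \<le> \<alpha>"
    and lim: "AE x in M. (\<lambda>n. u n x) \<longlonglongrightarrow> t x" and fin: "AE x in M. t x < \<top>"
    and le: "\<And>n. (\<integral>\<^sup>+x. powr0 \<alpha> (u n x * c x) \<partial>M) \<le> \<rho>"
  shows "(\<integral>\<^sup>+x. powr0 \<alpha> (t x * c x) \<partial>M) \<le> \<rho>"
proof -
  have "(\<integral>\<^sup>+x. powr0 \<alpha> (t x * c x) \<partial>M) \<le> (\<integral>\<^sup>+x. liminf (\<lambda>n. powr0 \<alpha> (u n x * c x)) \<partial>M)"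
    using lim fin
    by (intro nn_integral_mono_AE) (auto simp: powr0_mult[OF \<alpha>] intro: powr0_lsc elim!: AE_mp)
  also have "\<dots> \<le> liminf (\<lambda>n. \<integral>\<^sup>+x. powr0 \<alpha> (u n x * c x) \<partial>M)"
    by (rule nn_integral_liminf) measurable
  also have "\<dots> \<le> liminf (\<lambda>n. \<rho>)"
    by (intro Liminf_mono always_eventually allI le)
  finally show ?thesis by (simp add: Liminf_const)
qed

text \<open>Prepending an independent draw from \<open>M\<close> to an i.i.d. sequence leaves its
  law unchanged; Fubini does the rest. This lets observations be peeled off one at a time.\<close>

lemma (in sequence_space) nn_integral_PiM_iter:
  assumes [measurable]: "F \<in> borel_measurable S"
  shows "(\<integral>\<^sup>+x. F x \<partial>S) = (\<integral>\<^sup>+s. (\<integral>\<^sup>+\<omega>. F (case_nat s \<omega>) \<partial>S) \<partial>M)"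
proof -
  have "(\<integral>\<^sup>+x. F x \<partial>S) = (\<integral>\<^sup>+x. F x \<partial>distr (M \<Otimes>\<^sub>M S) S (\<lambda>(s, \<omega>). case_nat s \<omega>))"
    by (simp add: PiM_iter)
  also have "\<dots> = (\<integral>\<^sup>+z. F (case_nat (fst z) (snd z)) \<partial>(M \<Otimes>\<^sub>M S))"
    by (subst nn_integral_distr) (auto simp: case_prod_beta)
  also have "\<dots> = (\<integral>\<^sup>+s. (\<integral>\<^sup>+\<omega>. F (case_nat s \<omega>) \<partial>S) \<partial>M)"
    by (subst P.nn_integral_fst[symmetric]) auto
  finally show ?thesis .
qed

section \<open>Densities and likelihood ratios for a single observation\<close>

lemma (in dominated_model) measurable_density_model [measurable]:
  "P \<in> \<P> \<Longrightarrow> p P \<in> borel_measurable \<mu>"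
  using measurable_compose[OF measurable_Pair2' measurable_density, of P] by (simp add: space_prior)

text \<open>Domination of \<open>P0\<close> transfers the \<mu>-almost everywhere facts about
  densities, namely finiteness and agreement with \<open>RN_deriv\<close>, to the law of the
  observations. In the final theorem it is derived from the prior predictive hypothesis.\<close>

locale dominated_sample = dominated_model \<mu> \<P> prior p + P0: prob_space P0
  for \<mu> :: "'a measure" and \<P> prior p and P0 :: "'a measure" +
  assumes sets_P0: "sets P0 = sets \<mu>"
    and dominated_P0: "absolutely_continuous \<mu> P0"
begin

lemma AE_P0: "AE x in \<mu>. R x \<Longrightarrow> AE x in P0. R x"
  by (rule absolutely_continuous_AE[OF sets_P0 dominated_P0])

lemma measurable_P0: "f \<in> measurable \<mu> N \<Longrightarrow> f \<in> measurable P0 N"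
  by (simp cong: measurable_cong_sets add: sets_P0)

lemma measurable_density_sample:
  assumes "sets \<Lambda> = sets prior"
  shows "(\<lambda>(x, P). p P x) \<in> borel_measurable (P0 \<Otimes>\<^sub>M \<Lambda>)"
  using measurable_density assms sets_P0
  by (simp cong: measurable_cong_sets sets_pair_measure_cong)

lemma measurable_density_prior:
  "x \<in> space P0 \<Longrightarrow> (\<lambda>P. p P x) \<in> borel_measurable prior"
  using measurable_compose[OF measurable_Pair1' measurable_density_sample[OF refl]] by simp

lemma integral_density_model:
  assumes P: "P \<in> \<P>"
  shows "(\<integral>\<^sup>+x. p P x \<partial>\<mu>) = 1"
proof -
  interpret P: prob_space P by (rule prob_space_model[OF P])
  have "(\<integral>\<^sup>+x. p P x \<partial>\<mu>) = emeasure (density \<mu> (p P)) (space \<mu>)"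
    using P by (simp add: emeasure_density cong: nn_integral_cong)
  also have "\<dots> = 1"
    using P.emeasure_space_1 density_model[OF P] sets_eq_imp_space_eq[OF sets_model[OF P]] by simp
  finally show ?thesis .
qed

lemma density_finite: "P \<in> \<P> \<Longrightarrow> AE x in \<mu>. p P x < \<top>"
  using nn_integral_PInf_AE[of "p P" \<mu>] integral_density_model[of P]
  by (auto simp: top.not_eq_extremum)

text \<open>Radon-Nikodym derivatives are unique up to \<mu>-null sets, which are
  \<open>P0\<close>-null. The restriction to positive \<open>f\<close> is absorbed by
  \<open>powr0 \<alpha> 0 = 0\<close>.\<close>

lemma lr_transform_eq:
  assumes f [measurable]: "f \<in> borel_measurable \<mu>" and Q: "Q \<in> \<P>"
  shows "lr_transform \<mu> P0 (density \<mu> f) Q \<alpha> = (\<integral>\<^sup>+x. powr0 \<alpha> (f x * inverse (p Q x)) \<partial>P0)"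
  unfolding lr_transform_def
proof (rule nn_integral_cong_AE)
  have "AE x in P0. f x = RN_deriv \<mu> (density \<mu> f) x"
    by (intro AE_P0 RN_deriv_unique f refl)
  moreover have "AE x in P0. p Q x = RN_deriv \<mu> Q x"
    using Q by (intro AE_P0 RN_deriv_unique density_model measurable_density_model)
  \<comment> \<open>At an infinite value of \<open>p Q x\<close> the quotient would be 0 although
    \<open>f x\<close> may be positive, and for \<alpha> = 0 the two powers would differ: 1 against
    0.\<close>
  moreover have "AE x in P0. p Q x < \<top>"
    by (intro AE_P0 density_finite Q)
  ultimately show "AE x in P0. ennreal_powr (RN_deriv \<mu> (density \<mu> f) x / RN_deriv \<mu> Q x) \<alpha> *
      indicator {x. 0 < RN_deriv \<mu> (density \<mu> f) x} x = powr0 \<alpha> (f x * inverse (p Q x))"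
  proof eventually_elim
    case (elim x)
    then show ?case
      by (cases "f x = 0") (auto simp: powr0_def divide_ennreal_def zero_less_iff_neq_zero)
  qed
qed

lemma uniform_mixture_mem_convex_mixtures:
  assumes k: "0 < k" and Y: "\<And>j. j < k \<Longrightarrow> Y j \<in> V \<inter> \<P>"
  shows "density \<mu> (\<lambda>x. (\<Sum>j<k. p (Y j) x) / of_nat k) \<in> convex_mixtures \<mu> V"
  unfolding convex_mixtures_def
proof (intro CollectI conjI exI)
  \<comment> \<open>The points \<open>Y j\<close> may repeat, whereas the convex combination runs
    over distinct measures; the weights therefore count multiplicities.\<close>
  define w where "w Q = real (card {j\<in>{..<k}. Y j = Q}) / real k" for Q
  have card: "(\<Sum>Q\<in>Y ` {..<k}. card {j\<in>{..<k}. Y j = Q}) = k"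
    using sum.image_gen[of "{..<k}" "\<lambda>_. 1::nat" Y] by simp
  show "(\<Sum>Q\<in>Y ` {..<k}. w Q) = 1"
    unfolding w_def sum_divide_distrib[symmetric] of_nat_sum[symmetric] card using k by simp
  show "\<forall>A\<in>sets \<mu>. emeasure (density \<mu> (\<lambda>x. (\<Sum>j<k. p (Y j) x) / of_nat k)) A
      = (\<Sum>Q\<in>Y ` {..<k}. ennreal (w Q) * emeasure Q A)"
  proof
    fix A assume A [measurable]: "A \<in> sets \<mu>"
    have [measurable]: "p (Y j) \<in> borel_measurable \<mu>" if "j \<in> {..<k}" for j
      using Y that by auto
    have "emeasure (density \<mu> (\<lambda>x. (\<Sum>j<k. p (Y j) x) / of_nat k)) A
        = (\<integral>\<^sup>+x. (\<Sum>j<k. p (Y j) x * indicator A x) / of_nat k \<partial>\<mu>)"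
      by (subst emeasure_density) (auto simp: lessThan_def intro!: nn_integral_cong split: split_indicator)
    also have "\<dots> = (\<integral>\<^sup>+x. (\<Sum>j<k. p (Y j) x * indicator A x) \<partial>\<mu>) / of_nat k"
      by (rule nn_integral_divide) measurable
    also have "(\<integral>\<^sup>+x. (\<Sum>j<k. p (Y j) x * indicator A x) \<partial>\<mu>) = (\<Sum>j<k. \<integral>\<^sup>+x. p (Y j) x * indicator A x \<partial>\<mu>)"
      by (rule nn_integral_sum) measurable
    also have "\<dots> = (\<Sum>j<k. emeasure (Y j) A)"
      using density_model Y A by (intro sum.cong refl) (subst emeasure_density[symmetric], auto)
    also have "(\<Sum>j<k. emeasure (Y j) A) = (\<Sum>Q\<in>Y ` {..<k}. of_nat (card {j\<in>{..<k}. Y j = Q}) * emeasure Q A)"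
      by (subst sum.image_gen[of _ _ Y]) (auto intro!: sum.cong)
    also have "\<dots> / of_nat k = (\<Sum>Q\<in>Y ` {..<k}. ennreal (w Q) * emeasure Q A)"
    proof -
      have "ennreal (w Q) = of_nat (card {j\<in>{..<k}. Y j = Q}) * inverse (of_nat k)" for Q
        using k by (simp add: w_def divide_ennreal[symmetric] ennreal_of_nat_eq_real_of_nat divide_ennreal_def)
      then show ?thesis by (simp add: divide_ennreal_def sum_distrib_left mult_ac)
    qed
    finally show "emeasure (density \<mu> (\<lambda>x. (\<Sum>j<k. p (Y j) x) / of_nat k)) A
      = (\<Sum>Q\<in>Y ` {..<k}. ennreal (w Q) * emeasure Q A)" .
  qed
qed (use Y in auto)

text \<open>Maurey's method replaces the mixture over \<open>\<Lambda>\<close> by uniform mixtures of finitely many points of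
  \<open>V\<close>; it needs bounded densities, hence the truncation at \<open>M\<close>.\<close>

lemma powr0_mixture_le:
  assumes \<alpha>: "0 \<le> \<alpha>" and Q: "Q \<in> \<P>"
    and \<rho>: "\<And>P. P \<in> convex_mixtures \<mu> V \<Longrightarrow> lr_transform \<mu> P0 P Q \<alpha> \<le> \<rho>"
    and "prob_space \<Lambda>" and sets_\<Lambda>: "sets \<Lambda> = sets prior" and V: "AE P in \<Lambda>. P \<in> V"
  shows "(\<integral>\<^sup>+x. powr0 \<alpha> ((\<integral>\<^sup>+P. p P x \<partial>\<Lambda>) * inverse (p Q x)) \<partial>P0) \<le> \<rho>"
proof -
  interpret \<Lambda>: prob_space \<Lambda> by fact
  interpret L: pair_prob_space P0 \<Lambda> ..
  interpret L\<mu>: pair_sigma_finite \<mu> \<Lambda> ..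
  have space_\<Lambda>: "space \<Lambda> = \<P>" using sets_eq_imp_space_eq[OF sets_\<Lambda>] space_prior by simp
  note p_meas [measurable] = measurable_density_sample[OF sets_\<Lambda>]
  have [measurable]: "(\<lambda>(x, P). p P x) \<in> borel_measurable (\<mu> \<Otimes>\<^sub>M \<Lambda>)"
    using measurable_density sets_\<Lambda> by (simp cong: measurable_cong_sets sets_pair_measure_cong)
  have [measurable]: "p P \<in> borel_measurable P0" if "P \<in> \<P>" for P
    using that by (intro measurable_P0) measurable
  note Q [measurable]
  have trunc: "(\<integral>\<^sup>+x. powr0 \<alpha> ((\<integral>\<^sup>+P. min (p P x) (of_nat M) \<partial>\<Lambda>) * inverse (p Q x)) \<partial>P0) \<le> \<rho>" for M :: nat
  proof -
    define f where "f x P = enn2real (min (p P x) (of_nat M))" for x P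
    have f [measurable]: "(\<lambda>(x, P). f x P) \<in> borel_measurable (P0 \<Otimes>\<^sub>M \<Lambda>)"
      unfolding f_def by measurable
    have f_eq: "ennreal (f x P) = min (p P x) (of_nat M)" for x P
      unfolding f_def by (intro ennreal_enn2real) (simp add: min_less_iff_disj of_nat_less_top)
    have f_nonneg: "0 \<le> f x P" for x P by (simp add: f_def)
    have f_bound: "\<bar>f x P\<bar> \<le> M" for x P
      using enn2real_mono[of "min (p P x) (of_nat M)" "of_nat M"] by (simp add: f_def of_nat_less_top)
    obtain Y and r :: "nat \<Rightarrow> nat" where r: "\<And>n. 0 < r n" and Y: "\<And>n j. j < r n \<Longrightarrow> Y n j \<in> V \<inter> space \<Lambda>"
      and lim: "AE x in P0. (\<lambda>n. (\<Sum>j<r n. f x (Y n j)) / r n) \<longlonglongrightarrow> (\<integral>P. f x P \<partial>\<Lambda>)"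
      by (rule L.empirical_means_converge_AE[OF f f_bound V], rule that)
    have fY [measurable]: "(\<lambda>x. f x (Y n j)) \<in> borel_measurable P0" if "j < r n" for n j
      using Y[OF that] measurable_compose[OF measurable_Pair2' f, of "Y n j"] by simp
    have "(\<integral>\<^sup>+x. powr0 \<alpha> (ennreal (\<integral>P. f x P \<partial>\<Lambda>) * inverse (p Q x)) \<partial>P0) \<le> \<rho>"
    proof (rule powr0_fatou[where u = "\<lambda>n x. ennreal ((\<Sum>j<r n. f x (Y n j)) / r n)"])
      show "(\<lambda>x. ennreal ((\<Sum>j<r n. f x (Y n j)) / r n)) \<in> borel_measurable P0" for n
        by (intro measurable_compose[OF _ measurable_ennreal] borel_measurable_divide borel_measurable_sum fY) auto
      show "AE x in P0. (\<lambda>n. ennreal ((\<Sum>j<r n. f x (Y n j)) / r n)) \<longlonglongrightarrow> ennreal (\<integral>P. f x P \<partial>\<Lambda>)"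
        using lim by eventually_elim (rule tendsto_ennrealI)
      show "(\<integral>\<^sup>+x. powr0 \<alpha> (ennreal ((\<Sum>j<r n. f x (Y n j)) / r n) * inverse (p Q x)) \<partial>P0) \<le> \<rho>" for n
      proof -
        have Yn: "Y n j \<in> V \<inter> \<P>" if "j < r n" for j using Y[OF that] space_\<Lambda> by simp
        \<comment> \<open>Removing the truncation only increases the average, which is then the
          density of a member of the convex hull, so the bound \<rho> applies to it.\<close>
        have "ennreal ((\<Sum>j<r n. f x (Y n j)) / r n) \<le> (\<Sum>j<r n. p (Y n j) x) / of_nat (r n)" for x
        proof -
          have "ennreal ((\<Sum>j<r n. f x (Y n j)) / r n) = (\<Sum>j<r n. ennreal (f x (Y n j))) / of_nat (r n)"
            using r[of n] by (subst divide_ennreal[symmetric]) (auto simp: f_def sum_nonneg ennreal_of_nat_eq_real_of_nat)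
          also have "\<dots> \<le> (\<Sum>j<r n. p (Y n j) x) / of_nat (r n)"
            by (intro divide_right_mono_ennreal sum_mono) (simp add: f_eq)
          finally show ?thesis .
        qed
        then have "(\<integral>\<^sup>+x. powr0 \<alpha> (ennreal ((\<Sum>j<r n. f x (Y n j)) / r n) * inverse (p Q x)) \<partial>P0)
          \<le> (\<integral>\<^sup>+x. powr0 \<alpha> ((\<Sum>j<r n. p (Y n j) x) / of_nat (r n) * inverse (p Q x)) \<partial>P0)"
          by (intro nn_integral_mono powr0_mono \<alpha> mult_right_mono) auto
        also have "\<dots> = lr_transform \<mu> P0 (density \<mu> (\<lambda>x. (\<Sum>j<r n. p (Y n j) x) / of_nat (r n))) Q \<alpha>"
          using Yn by (intro lr_transform_eq[symmetric] Q borel_measurable_divide_ennreal borel_measurable_sum) auto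
        also have "\<dots> \<le> \<rho>"
          by (intro \<rho> uniform_mixture_mem_convex_mixtures r Yn)
        finally show ?thesis .
      qed
    qed (use \<alpha> in auto)
    also have "ennreal (\<integral>P. f x P \<partial>\<Lambda>) = (\<integral>\<^sup>+P. min (p P x) (of_nat M) \<partial>\<Lambda>)" if x: "x \<in> space P0" for x
    proof -
      have "f x \<in> borel_measurable \<Lambda>"
        using measurable_compose[OF measurable_Pair1'[OF x] f] by simp
      then have "integrable \<Lambda> (f x)" using f_bound by (intro \<Lambda>.integrable_bounded)
      then show ?thesis
        unfolding f_eq[symmetric] by (intro nn_integral_eq_integral[symmetric] AE_I2) (simp_all only: f_nonneg)
    qed
    then have "(\<integral>\<^sup>+x. powr0 \<alpha> (ennreal (\<integral>P. f x P \<partial>\<Lambda>) * inverse (p Q x)) \<partial>P0) =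
        (\<integral>\<^sup>+x. powr0 \<alpha> ((\<integral>\<^sup>+P. min (p P x) (of_nat M) \<partial>\<Lambda>) * inverse (p Q x)) \<partial>P0)"
      by (intro nn_integral_cong) simp
    finally show ?thesis .
  qed
  \<comment> \<open>\<open>powr0_fatou\<close> needs a finite limit. By Tonelli the mixture density
    has \<mu>-integral 1.\<close>
  have fin: "AE x in P0. (\<integral>\<^sup>+P. p P x \<partial>\<Lambda>) < \<top>"
  proof (rule AE_P0)
    have "(\<integral>\<^sup>+x. (\<integral>\<^sup>+P. p P x \<partial>\<Lambda>) \<partial>\<mu>) = (\<integral>\<^sup>+P. (\<integral>\<^sup>+x. p P x \<partial>\<mu>) \<partial>\<Lambda>)"
      by (rule L\<mu>.Fubini'[symmetric]) measurable
    also have "\<dots> = (\<integral>\<^sup>+P. 1 \<partial>\<Lambda>)"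
      using integral_density_model space_\<Lambda> by (intro nn_integral_cong) simp
    finally have "(\<integral>\<^sup>+x. (\<integral>\<^sup>+P. p P x \<partial>\<Lambda>) \<partial>\<mu>) = 1" by (simp add: \<Lambda>.emeasure_space_1)
    then show "AE x in \<mu>. (\<integral>\<^sup>+P. p P x \<partial>\<Lambda>) < \<top>"
      using nn_integral_PInf_AE[of "\<lambda>x. \<integral>\<^sup>+P. p P x \<partial>\<Lambda>" \<mu>] by (auto simp: top.not_eq_extremum)
  qed
  have lim: "(\<lambda>M. \<integral>\<^sup>+P. min (p P x) (of_nat M) \<partial>\<Lambda>) \<longlonglongrightarrow> (\<integral>\<^sup>+P. p P x \<partial>\<Lambda>)" if x: "x \<in> space P0" for x
  proof (rule nn_integral_LIMSEQ)
    show "incseq (\<lambda>M P. min (p P x) (of_nat M))"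
      unfolding incseq_def le_fun_def by (intro allI impI min.mono order_refl of_nat_mono)
    have "(\<lambda>P. p P x) \<in> borel_measurable \<Lambda>"
      using measurable_compose[OF measurable_Pair1'[OF x] p_meas] by simp
    then show "(\<lambda>P. min (p P x) (of_nat M)) \<in> borel_measurable \<Lambda>" for M by simp
    show "(\<lambda>M. min (p P x) (of_nat M)) \<longlonglongrightarrow> p P x" for P
      using tendsto_min[OF tendsto_const of_nat_tendsto_top_ennreal, of "p P x"] by simp
  qed
  show ?thesis
  proof (rule powr0_fatou[where u = "\<lambda>M x. \<integral>\<^sup>+P. min (p P x) (of_nat M) \<partial>\<Lambda>"])
    show "AE x in P0. (\<lambda>M. \<integral>\<^sup>+P. min (p P x) (of_nat M) \<partial>\<Lambda>) \<longlonglongrightarrow> (\<integral>\<^sup>+P. p P x \<partial>\<Lambda>)"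
      by (intro AE_I2 lim)
    show "(\<lambda>x. \<integral>\<^sup>+P. min (p P x) (of_nat M) \<partial>\<Lambda>) \<in> borel_measurable P0" for M :: nat
      by measurable
    show "(\<lambda>x. \<integral>\<^sup>+P. p P x \<partial>\<Lambda>) \<in> borel_measurable P0"
      by measurable
    show "(\<lambda>x. inverse (p Q x)) \<in> borel_measurable P0"
      by measurable
  qed (rule \<alpha> fin trunc)+
qed

text \<open>Normalising the weight \<open>g\<close> on \<open>V\<close> gives a probability measure
  to which \<open>powr0_mixture_le\<close> applies; the normalising constant comes out of the power
  by multiplicativity. If it is 0, the left side vanishes.\<close>

lemma powr0_weighted_mixture_le:
  assumes \<alpha>: "0 \<le> \<alpha>" and Q: "Q \<in> \<P>"
    and \<rho>: "\<And>P. P \<in> convex_mixtures \<mu> V \<Longrightarrow> lr_transform \<mu> P0 P Q \<alpha> \<le> \<rho>"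
    and V [measurable]: "V \<in> sets prior"
    and g [measurable]: "g \<in> borel_measurable prior" and fin: "(\<integral>\<^sup>+P\<in>V. g P \<partial>prior) < \<top>"
  shows "(\<integral>\<^sup>+x. powr0 \<alpha> ((\<integral>\<^sup>+P\<in>V. g P * p P x \<partial>prior) * inverse (p Q x)) \<partial>P0)
    \<le> powr0 \<alpha> (\<integral>\<^sup>+P\<in>V. g P \<partial>prior) * \<rho>"
proof -
  define c where "c = (\<integral>\<^sup>+P\<in>V. g P \<partial>prior)"
  note [measurable] = measurable_P0[OF measurable_density_model]
  show ?thesis
  proof (cases "c = 0")
    case True
    then have "AE P in prior. g P * indicator V P = 0"
      unfolding c_def by (subst (asm) nn_integral_0_iff_AE) auto
    then have "(\<integral>\<^sup>+P\<in>V. g P * p P x \<partial>prior) = 0" for x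
      by (subst nn_integral_cong_AE[where v = "\<lambda>_. 0"]) (auto elim!: eventually_mono simp: indicator_def)
    then show ?thesis by simp
  next
    case False
    define \<Lambda> where "\<Lambda> = density prior (\<lambda>P. g P * indicator V P / c)"
    have c: "c \<noteq> 0" "c < \<top>" using False fin c_def by auto
    have "prob_space \<Lambda>"
    proof
      have "emeasure \<Lambda> (space \<Lambda>) = (\<integral>\<^sup>+P. g P * indicator V P / c \<partial>prior)"
        unfolding \<Lambda>_def by (simp add: emeasure_density cong: nn_integral_cong)
      also have "\<dots> = c / c" unfolding c_def by (rule nn_integral_divide) measurable
      finally show "emeasure \<Lambda> (space \<Lambda>) = 1" using c by simp
    qed
    moreover have "AE P in \<Lambda>. P \<in> V"
      unfolding \<Lambda>_def by (subst AE_density) (auto intro!: AE_I2 simp: indicator_def)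
    ultimately have le: "(\<integral>\<^sup>+x. powr0 \<alpha> ((\<integral>\<^sup>+P. p P x \<partial>\<Lambda>) * inverse (p Q x)) \<partial>P0) \<le> \<rho>"
      by (intro powr0_mixture_le[OF \<alpha> Q \<rho>]) (auto simp: \<Lambda>_def)
    have eq: "(\<integral>\<^sup>+P\<in>V. g P * p P x \<partial>prior) = c * (\<integral>\<^sup>+P. p P x \<partial>\<Lambda>)" if x: "x \<in> space P0" for x
    proof -
      note [measurable] = measurable_density_prior[OF x]
      have "c * (\<integral>\<^sup>+P. p P x \<partial>\<Lambda>) = c * (\<integral>\<^sup>+P. (g P * p P x * indicator V P) / c \<partial>prior)"
        unfolding \<Lambda>_def by (subst nn_integral_density) (auto simp: divide_ennreal_def mult_ac)
      also have "\<dots> = c * ((\<integral>\<^sup>+P\<in>V. g P * p P x \<partial>prior) / c)"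
        by (subst nn_integral_divide) auto
      finally show ?thesis using c by (simp add: ennreal_times_divide mult.commute[of c] ennreal_mult_divide_eq)
    qed
    have "(\<integral>\<^sup>+x. powr0 \<alpha> ((\<integral>\<^sup>+P\<in>V. g P * p P x \<partial>prior) * inverse (p Q x)) \<partial>P0)
      = (\<integral>\<^sup>+x. powr0 \<alpha> c * powr0 \<alpha> ((\<integral>\<^sup>+P. p P x \<partial>\<Lambda>) * inverse (p Q x)) \<partial>P0)"
      by (intro nn_integral_cong) (simp only: eq powr0_mult[OF \<alpha>] mult.assoc[of "powr0 \<alpha> c"])
    also have "\<dots> = powr0 \<alpha> c * (\<integral>\<^sup>+x. powr0 \<alpha> ((\<integral>\<^sup>+P. p P x \<partial>\<Lambda>) * inverse (p Q x)) \<partial>P0)"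
    proof (rule nn_integral_cmult)
      interpret \<Lambda>: prob_space \<Lambda> by fact
      have [measurable]: "(\<lambda>(x, P). p P x) \<in> borel_measurable (P0 \<Otimes>\<^sub>M \<Lambda>)"
        by (rule measurable_density_sample) (simp add: \<Lambda>_def)
      show "(\<lambda>x. powr0 \<alpha> ((\<integral>\<^sup>+P. p P x \<partial>\<Lambda>) * inverse (p Q x))) \<in> borel_measurable P0"
        using Q by measurable
    qed
    also have "\<dots> \<le> powr0 \<alpha> c * \<rho>" by (intro mult_left_mono le) simp
    finally show ?thesis by (simp add: c_def)
  qed
qed

section \<open>Likelihoods of i.i.d. samples\<close>

sublocale S: sequence_space P0 ..

abbreviation "S \<equiv> \<Pi>\<^sub>M i\<in>(UNIV :: nat set). P0"

lemma measurable_likelihood [measurable]: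
  "(\<lambda>(x, P). \<Prod>i<n. p P (x i)) \<in> borel_measurable (S \<Otimes>\<^sub>M prior)"
proof -
  have "(\<lambda>z. p (snd z) (fst z i)) \<in> borel_measurable (S \<Otimes>\<^sub>M prior)" for i
  proof -
    have "(\<lambda>z. (fst z i, snd z)) \<in> measurable (S \<Otimes>\<^sub>M prior) (P0 \<Otimes>\<^sub>M prior)"
      by measurable
    from measurable_compose[OF this measurable_density_sample[OF refl]] show ?thesis by simp
  qed
  then show ?thesis unfolding case_prod_beta by (intro borel_measurable_prod_ennreal)
qed

text \<open>The induction peels off the first observation \<open>s\<close>, whose likelihood is absorbed into the weight \<open>g\<close>.\<close>

lemma powr0_likelihood_ratio_le:
  assumes \<alpha>: "0 \<le> \<alpha>" and Q: "Q \<in> \<P>"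
    and \<rho>: "\<And>P. P \<in> convex_mixtures \<mu> V \<Longrightarrow> lr_transform \<mu> P0 P Q \<alpha> \<le> \<rho>"
    and V [measurable]: "V \<in> sets prior"
    and "g \<in> borel_measurable prior" and "(\<integral>\<^sup>+P\<in>V. g P \<partial>prior) < \<top>"
  shows "(\<integral>\<^sup>+x. powr0 \<alpha> ((\<integral>\<^sup>+P\<in>V. g P * (\<Prod>i<n. p P (x i)) \<partial>prior) * (\<Prod>i<n. inverse (p Q (x i)))) \<partial>S)
    \<le> powr0 \<alpha> (\<integral>\<^sup>+P\<in>V. g P \<partial>prior) * \<rho> ^ n"
  using assms(5,6)
proof (induction n arbitrary: g)
  case 0
  then show ?case by (simp add: S.P.emeasure_space_1)
next
  case (Suc n)
  note [measurable] = Suc.prems(1) measurable_P0[OF measurable_density_model] measurable_density_sample[OF refl]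
  interpret \<mu>p: pair_sigma_finite \<mu> prior ..
  note Q [measurable]
  define h where "h s = (\<integral>\<^sup>+P\<in>V. g P * p P s \<partial>prior)" for s
  have [measurable]: "h \<in> borel_measurable P0" unfolding h_def by measurable
  \<comment> \<open>The induction hypothesis is applied with weight \<open>g P * p P s\<close>,
    whose mass \<open>h s\<close> on \<open>V\<close> must be finite. By Tonelli the \<mu>-integral
    of \<open>h\<close> is the mass of \<open>g\<close> on \<open>V\<close>.\<close>
  have fin: "AE s in P0. h s < \<top>"
  proof (rule AE_P0)
    note [measurable] = measurable_density
    have [measurable]: "h \<in> borel_measurable \<mu>" unfolding h_def by measurable
    have "(\<integral>\<^sup>+s. h s \<partial>\<mu>) = (\<integral>\<^sup>+P. (\<integral>\<^sup>+s. g P * p P s * indicator V P \<partial>\<mu>) \<partial>prior)"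
      unfolding h_def by (rule \<mu>p.Fubini'[symmetric]) measurable
    also have "\<dots> = (\<integral>\<^sup>+P\<in>V. g P \<partial>prior)"
    proof (rule nn_integral_cong)
      fix P assume "P \<in> space prior"
      then have "P \<in> \<P>" by (simp add: space_prior)
      then show "(\<integral>\<^sup>+s. g P * p P s * indicator V P \<partial>\<mu>) = g P * indicator V P"
        using integral_density_model[of P]
        by (simp add: nn_integral_cmult nn_integral_multc)
    qed
    finally show "AE s in \<mu>. h s < \<top>"
      using Suc.prems(2) nn_integral_PInf_AE[of h \<mu>] by (auto simp: top.not_eq_extremum)
  qed
  define F where "F x = powr0 \<alpha> ((\<integral>\<^sup>+P\<in>V. g P * (\<Prod>i<Suc n. p P (x i)) \<partial>prior) * (\<Prod>i<Suc n. inverse (p Q (x i))))" for x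
  have [measurable]: "F \<in> borel_measurable S"
    unfolding F_def by measurable
  have "(\<integral>\<^sup>+x. F x \<partial>S) = (\<integral>\<^sup>+s. (\<integral>\<^sup>+\<omega>. F (case_nat s \<omega>) \<partial>S) \<partial>P0)"
    by (rule S.nn_integral_PiM_iter) measurable
  also have "\<dots> \<le> (\<integral>\<^sup>+s. powr0 \<alpha> (h s * inverse (p Q s)) * \<rho> ^ n \<partial>P0)"
  proof (rule nn_integral_mono_AE)
    show "AE s in P0. (\<integral>\<^sup>+\<omega>. F (case_nat s \<omega>) \<partial>S) \<le> powr0 \<alpha> (h s * inverse (p Q s)) * \<rho> ^ n"
      using fin AE_space
    proof eventually_elim
      case (elim s)
      note [measurable] = measurable_density_prior[OF elim(2)]
      define G where "G \<omega> = powr0 \<alpha> ((\<integral>\<^sup>+P\<in>V. (g P * p P s) * (\<Prod>i<n. p P (\<omega> i)) \<partial>prior) * (\<Prod>i<n. inverse (p Q (\<omega> i))))" for \<omega>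
      have [measurable]: "G \<in> borel_measurable S" unfolding G_def by measurable
      \<comment> \<open>The factor \<open>p P s\<close> joins the weight inside the integral over
        \<open>V\<close>, while \<open>inverse (p Q s)\<close> is constant in \<omega> and leaves
        the integral.\<close>
      have "F (case_nat s \<omega>) = powr0 \<alpha> (inverse (p Q s)) * G \<omega>" for \<omega>
        unfolding F_def G_def powr0_mult[OF \<alpha>, symmetric] prod.lessThan_Suc_shift
        by (simp add: mult_ac)
      then have "(\<integral>\<^sup>+\<omega>. F (case_nat s \<omega>) \<partial>S) = powr0 \<alpha> (inverse (p Q s)) * (\<integral>\<^sup>+\<omega>. G \<omega> \<partial>S)"
        by (simp add: nn_integral_cmult)
      also have "\<dots> \<le> powr0 \<alpha> (inverse (p Q s)) * (powr0 \<alpha> (h s) * \<rho> ^ n)"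
        unfolding G_def h_def using elim(1)
        by (intro mult_left_mono Suc.IH) (auto simp: h_def)
      finally show ?case by (simp add: powr0_mult[OF \<alpha>] mult_ac)
    qed
  qed
  also have "\<dots> = (\<integral>\<^sup>+s. powr0 \<alpha> (h s * inverse (p Q s)) \<partial>P0) * \<rho> ^ n"
    by (rule nn_integral_multc) measurable
  \<comment> \<open>What remains is the one-observation bound for the original weight
    \<open>g\<close>, giving the last factor \<rho>.\<close>
  also have "\<dots> \<le> (powr0 \<alpha> (\<integral>\<^sup>+P\<in>V. g P \<partial>prior) * \<rho>) * \<rho> ^ n"
    unfolding h_def using Suc.prems by (intro mult_right_mono powr0_weighted_mixture_le[OF \<alpha> Q \<rho> V]) auto
  finally show ?case by (simp add: F_def mult_ac)
qed

end

section \<open>Posterior convergence\<close>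

lemma suminf_ennreal_finite_imp_tendsto_0:
  fixes f :: "nat \<Rightarrow> ennreal"
  assumes "(\<Sum>n. f n) < \<top>"
  shows "f \<longlonglongrightarrow> 0"
proof -
  have "f n < \<top>" for n
    using le_less_trans[OF sum_le_suminf[of f "{n}"] assms] by simp
  then have f: "f = (\<lambda>n. ennreal (enn2real (f n)))" by simp
  have "summable (\<lambda>n. enn2real (f n))"
    using assms by (intro summable_suminf_not_top) (simp_all flip: f)
  from summable_LIMSEQ_zero[OF this] show ?thesis
    by (subst f) (simp only: ennreal_0[symmetric] tendsto_ennrealI)
qed

text \<open>The geometric series bounds the integral of the sum of all \<open>f n\<close>. That sum
  is thus finite almost everywhere, and its terms tend to 0.\<close>

lemma AE_tendsto_0_if_nn_integral_geometric:
  fixes f :: "nat \<Rightarrow> 'b \<Rightarrow> ennreal"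
  assumes [measurable]: "\<And>n. f n \<in> borel_measurable M"
    and le: "\<And>n. (\<integral>\<^sup>+x. f n x \<partial>M) \<le> C * \<rho> ^ n" and C: "C < \<top>" and \<rho>: "\<rho> < 1"
  shows "AE x in M. (\<lambda>n. f n x) \<longlonglongrightarrow> 0"
proof -
  obtain r where r: "0 \<le> r" "\<rho> = ennreal r" "r < 1"
    using \<rho> by (cases \<rho>) auto
  have "(\<integral>\<^sup>+x. (\<Sum>n. f n x) \<partial>M) = (\<Sum>n. \<integral>\<^sup>+x. f n x \<partial>M)"
    by (rule nn_integral_suminf) measurable
  also have "\<dots> \<le> (\<Sum>n. C * ennreal (r ^ n))"
    using le r by (intro suminf_le) (auto simp: ennreal_power)
  also have "\<dots> = C * ennreal (1 / (1 - r))"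
    using r by (subst ennreal_suminf_cmult, subst suminf_ennreal_eq[OF _ geometric_sums]) auto
  also have "\<dots> < \<top>" using C by (simp add: ennreal_mult_less_top)
  finally have "AE x in M. (\<Sum>n. f n x) < \<top>"
    using nn_integral_PInf_AE[of "\<lambda>x. \<Sum>n. f n x" M] by (auto simp: top.not_eq_extremum)
  then show ?thesis
    by eventually_elim (rule suminf_ennreal_finite_imp_tendsto_0)
qed

lemma inverse_antimono_ennreal: "a \<le> b \<Longrightarrow> inverse b \<le> inverse (a :: ennreal)"
  by (cases a; cases b; cases "a = 0"; cases "b = 0")
     (auto simp: inverse_ennreal top_unique intro!: ennreal_leI le_imp_inverse_le)

text \<open>A quotient at most 1 does not decrease under a power with exponent in [0,1]; shrinking
  the denominator to an integral over \<open>B\<close> increases it further.\<close>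

lemma posterior_le_powr0:
  assumes \<alpha>: "0 \<le> \<alpha>" "\<alpha> \<le> 1"
  shows "posterior p prior n x V \<le>
    powr0 \<alpha> ((\<integral>\<^sup>+P\<in>V. (\<Prod>i<n. p P (x i)) \<partial>prior) * inverse (\<integral>\<^sup>+P\<in>B. (\<Prod>i<n. p P (x i)) \<partial>prior))"
proof -
  define D where "D A = (\<integral>\<^sup>+P\<in>A. (\<Prod>i<n. p P (x i)) \<partial>prior)" for A
  have D_le: "D A \<le> D UNIV" for A
    unfolding D_def by (intro nn_integral_mono) (simp split: split_indicator)
  have eq: "posterior p prior n x V = D V / D UNIV" by (simp add: posterior_def D_def)
  have "D V / D UNIV \<le> D UNIV / D UNIV" by (intro divide_right_mono_ennreal D_le)
  \<comment> \<open>If the total mass is 0 or \<top>, the default value of the quotient is 0, so the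
    bound persists.\<close>
  also have "\<dots> \<le> 1"
    by (cases "D UNIV = 0 \<or> D UNIV = \<top>") (auto simp: top.not_eq_extremum)
  finally have "posterior p prior n x V \<le> powr0 \<alpha> (D V / D UNIV)"
    unfolding eq by (intro le_powr0 \<alpha>)
  also have "\<dots> \<le> powr0 \<alpha> (D V * inverse (D B))"
    unfolding divide_ennreal_def by (intro powr0_mono \<alpha> mult_left_mono inverse_antimono_ennreal D_le) simp
  finally show ?thesis by (simp add: D_def)
qed

text \<open>Division is multiplication by one common inverse, so the inequality between numerators
  carries over even where the quotient takes a default value.\<close>

lemma posterior_subadditive:
  assumes "finite I" "U \<subseteq> (\<Union>i\<in>I. V i)"
    and [measurable]: "\<And>i. i \<in> I \<Longrightarrow> V i \<in> sets prior"
    and [measurable]: "(\<lambda>P. \<Prod>i<n. p P (x i)) \<in> borel_measurable prior"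
  shows "posterior p prior n x U \<le> (\<Sum>i\<in>I. posterior p prior n x (V i))"
proof -
  let ?L = "\<lambda>P. \<Prod>i<n. p P (x i)"
  have "(\<integral>\<^sup>+P\<in>U. ?L P \<partial>prior) \<le> (\<integral>\<^sup>+P. (\<Sum>i\<in>I. ?L P * indicator (V i) P) \<partial>prior)"
  proof (rule nn_integral_mono)
    fix P
    show "?L P * indicator U P \<le> (\<Sum>i\<in>I. ?L P * indicator (V i) P)"
    proof (cases "P \<in> U")
      case True
      then obtain i where "i \<in> I" "P \<in> V i" using assms by auto
      then have "?L P * indicator U P \<le> ?L P * indicator (V i) P" by (auto split: split_indicator)
      also have "\<dots> \<le> (\<Sum>i\<in>I. ?L P * indicator (V i) P)"
        using \<open>i \<in> I\<close> assms(1) by (intro member_le_sum) auto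
      finally show ?thesis .
    qed simp
  qed
  also have "\<dots> = (\<Sum>i\<in>I. \<integral>\<^sup>+P\<in>V i. ?L P \<partial>prior)"
    by (rule nn_integral_sum) measurable
  finally show ?thesis
    unfolding posterior_def divide_ennreal_def sum_distrib_right[symmetric] by (rule mult_right_mono) simp
qed

section \<open>Almost sure decay of the posterior\<close>

context dominated_sample
begin

text \<open>In \<open>ennreal\<close> the inverse of a product fails to factor when a factor 0 meets
  a factor \<top>. Almost surely no observation has infinite density, which excludes this.\<close>

lemma AE_inverse_likelihood:
  assumes Q: "Q \<in> \<P>"
  shows "AE x in S. inverse (\<Prod>i<n. p Q (x i)) = (\<Prod>i<n. inverse (p Q (x i)))"
proof -
  have "AE x in S. p Q (x i) < \<top>" for i
    by (rule AE_PiM_component[where M = "\<lambda>_. P0" and P = "\<lambda>y. p Q y < \<top>"])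
      (auto intro: AE_P0 density_finite Q P0.prob_space_axioms)
  then have "AE x in S. \<forall>i. p Q (x i) < \<top>" by (simp add: AE_all_countable)
  then show ?thesis
  proof eventually_elim
    case (elim x)
    show ?case
    proof (induction n)
      case (Suc n)
      have "(\<Prod>i<n. p Q (x i)) < \<top>"
        using elim by (auto simp: ennreal_prod_eq_top less_top[symmetric])
      then show ?case using Suc elim by (simp add: ennreal_inverse_mult)
    qed simp
  qed
qed

lemma measurable_likelihood_prior:
  "x \<in> space S \<Longrightarrow> (\<lambda>P. \<Prod>i<n. p P (x i)) \<in> borel_measurable prior"
  using measurable_compose[OF measurable_Pair1' measurable_likelihood] by simp

lemma measurable_posterior:
  assumes [measurable]: "V \<in> sets prior"
  shows "(\<lambda>x. posterior p prior n x V) \<in> borel_measurable S"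
  unfolding posterior_def by measurable

lemma nn_integral_posterior_le:
  assumes \<alpha>: "0 \<le> \<alpha>" "\<alpha> \<le> 1"
    and \<rho>: "\<And>P Q. P \<in> convex_mixtures \<mu> V \<Longrightarrow> Q \<in> B \<Longrightarrow> lr_transform \<mu> P0 P Q \<alpha> \<le> \<rho>"
    and V [measurable]: "V \<in> sets prior" and B [measurable]: "B \<in> sets prior"
    and B_pos: "emeasure prior B \<noteq> 0"
  shows "(\<integral>\<^sup>+x. posterior p prior n x V \<partial>S)
    \<le> powr0 \<alpha> (inverse (emeasure prior B)) * powr0 \<alpha> (emeasure prior V) * \<rho> ^ n"
proof -
  \<comment> \<open>The prior conditioned on \<open>B\<close>. Jensen's inequality requires a
    probability measure, and the normalising mass \<open>\<beta>\<close> accounts for the first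
    factor of the bound.\<close>
  define \<Lambda> where "\<Lambda> = uniform_measure prior B"
  define \<beta> where "\<beta> = emeasure prior B"
  define L where "L x P = (\<Prod>i<n. p P (x i))" for x P
  define h where "h x = (\<integral>\<^sup>+P\<in>V. L x P \<partial>prior)" for x
  have \<beta>: "0 < \<beta>" "\<beta> < \<top>"
    using B_pos by (auto simp: \<beta>_def zero_less_iff_neq_zero less_top[symmetric])
  have sets_\<Lambda>: "sets \<Lambda> = sets prior" by (simp add: \<Lambda>_def)
  interpret \<Lambda>: prob_space \<Lambda>
    unfolding \<Lambda>_def using B_pos by (intro prob_space_uniform_measure) auto
  interpret SL: pair_sigma_finite S \<Lambda> ..
  have L_meas [measurable]: "(\<lambda>(x, P). L x P) \<in> borel_measurable (S \<Otimes>\<^sub>M prior)"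
    unfolding L_def by measurable
  have [measurable]: "(\<lambda>(x, P). L x P) \<in> borel_measurable (S \<Otimes>\<^sub>M \<Lambda>)"
    using L_meas sets_\<Lambda> by (simp cong: measurable_cong_sets sets_pair_measure_cong)
  have Lx: "L x \<in> borel_measurable prior" if "x \<in> space S" for x
    using measurable_likelihood_prior[OF that] by (simp add: L_def[abs_def])
  have [measurable]: "h \<in> borel_measurable S" unfolding h_def by measurable
  have "(\<integral>\<^sup>+x. posterior p prior n x V \<partial>S)
    \<le> (\<integral>\<^sup>+x. powr0 \<alpha> (inverse \<beta>) * (\<integral>\<^sup>+Q. powr0 \<alpha> (h x * inverse (L x Q)) \<partial>\<Lambda>) \<partial>S)"
  proof (rule nn_integral_mono)
    fix x assume x: "x \<in> space S"
    note [measurable] = Lx[OF x]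
    have [measurable]: "L x \<in> borel_measurable \<Lambda>"
      using Lx[OF x] by (simp cong: measurable_cong_sets add: sets_\<Lambda>)
    have "(\<integral>\<^sup>+Q. L x Q \<partial>\<Lambda>) = (\<integral>\<^sup>+Q\<in>B. L x Q \<partial>prior) / \<beta>"
      unfolding \<Lambda>_def \<beta>_def by (rule nn_integral_uniform_measure) measurable
    then have D: "(\<integral>\<^sup>+Q\<in>B. L x Q \<partial>prior) = \<beta> * (\<integral>\<^sup>+Q. L x Q \<partial>\<Lambda>)"
      using \<beta> by (simp add: ennreal_times_divide mult.commute[of \<beta>] ennreal_mult_divide_eq)
    have "posterior p prior n x V \<le> powr0 \<alpha> (h x * inverse (\<integral>\<^sup>+Q\<in>B. L x Q \<partial>prior))"
      unfolding h_def L_def by (rule posterior_le_powr0[OF \<alpha>])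
    also have "\<dots> = powr0 \<alpha> (h x) * (powr0 \<alpha> (inverse \<beta>) * powr0 \<alpha> (inverse (\<integral>\<^sup>+Q. L x Q \<partial>\<Lambda>)))"
      unfolding D using \<beta> by (simp add: powr0_mult[OF \<alpha>(1)] ennreal_inverse_mult')
    also have "\<dots> \<le> powr0 \<alpha> (h x) * (powr0 \<alpha> (inverse \<beta>) * (\<integral>\<^sup>+Q. powr0 \<alpha> (inverse (L x Q)) \<partial>\<Lambda>))"
      by (intro mult_left_mono \<Lambda>.powr0_inverse_jensen \<alpha>) auto
    also have "\<dots> = powr0 \<alpha> (inverse \<beta>) * (\<integral>\<^sup>+Q. powr0 \<alpha> (h x * inverse (L x Q)) \<partial>\<Lambda>)"
      unfolding powr0_mult[OF \<alpha>(1)] by (subst nn_integral_cmult) (auto simp: mult_ac)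
    finally show "posterior p prior n x V
      \<le> powr0 \<alpha> (inverse \<beta>) * (\<integral>\<^sup>+Q. powr0 \<alpha> (h x * inverse (L x Q)) \<partial>\<Lambda>)" .
  qed
  also have "\<dots> = powr0 \<alpha> (inverse \<beta>) * (\<integral>\<^sup>+x. (\<integral>\<^sup>+Q. powr0 \<alpha> (h x * inverse (L x Q)) \<partial>\<Lambda>) \<partial>S)"
    by (rule nn_integral_cmult) measurable
  also have "(\<integral>\<^sup>+x. (\<integral>\<^sup>+Q. powr0 \<alpha> (h x * inverse (L x Q)) \<partial>\<Lambda>) \<partial>S)
      = (\<integral>\<^sup>+Q. (\<integral>\<^sup>+x. powr0 \<alpha> (h x * inverse (L x Q)) \<partial>S) \<partial>\<Lambda>)"
    by (rule SL.Fubini'[symmetric]) measurable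
  also have "\<dots> \<le> (\<integral>\<^sup>+Q. powr0 \<alpha> (emeasure prior V) * \<rho> ^ n \<partial>\<Lambda>)"
  proof (rule nn_integral_mono_AE)
    have "AE Q in \<Lambda>. Q \<in> B"
      unfolding \<Lambda>_def by (rule AE_uniform_measureI) auto
    then show "AE Q in \<Lambda>. (\<integral>\<^sup>+x. powr0 \<alpha> (h x * inverse (L x Q)) \<partial>S) \<le> powr0 \<alpha> (emeasure prior V) * \<rho> ^ n"
    proof eventually_elim
      case (elim Q)
      then have Q: "Q \<in> \<P>" using sets.sets_into_space[OF B] space_prior by auto
      \<comment> \<open>The constant weight 1 brings the integral into the form of
        \<open>powr0_likelihood_ratio_le\<close>; its mass on \<open>V\<close> is the prior mass of
        \<open>V\<close>.\<close>
      have "(\<integral>\<^sup>+x. powr0 \<alpha> (h x * inverse (L x Q)) \<partial>S)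
        = (\<integral>\<^sup>+x. powr0 \<alpha> ((\<integral>\<^sup>+P\<in>V. 1 * (\<Prod>i<n. p P (x i)) \<partial>prior) * (\<Prod>i<n. inverse (p Q (x i)))) \<partial>S)"
        unfolding h_def L_def mult_1
        using AE_inverse_likelihood[OF Q, of n] by (intro nn_integral_cong_AE) (auto elim!: eventually_mono)
      also have "\<dots> \<le> powr0 \<alpha> (\<integral>\<^sup>+P\<in>V. 1 \<partial>prior) * \<rho> ^ n"
        using elim by (intro powr0_likelihood_ratio_le \<alpha> Q \<rho> V) (auto simp: less_top[symmetric])
      finally show ?case by simp
    qed
  qed
  also have "\<dots> = powr0 \<alpha> (emeasure prior V) * \<rho> ^ n"
    by (simp add: \<Lambda>.emeasure_space_1)
  finally show ?thesis by (simp add: \<beta>_def mult_left_mono mult.assoc)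
qed

lemma AE_posterior_tendsto_0:
  assumes V: "V \<in> sets prior" and B: "B \<in> sets prior" and B_pos: "emeasure prior B \<noteq> 0"
    and sep: "separation \<mu> P0 (convex_mixtures \<mu> V) B < 1"
  shows "AE x in S. (\<lambda>n. posterior p prior n x V) \<longlonglongrightarrow> 0"
proof -
  \<comment> \<open>An infimum below 1 is undercut at some exponent, and the supremum there serves
    as \<rho> for all \<open>P\<close> and \<open>Q\<close> at once.\<close>
  obtain \<alpha> where \<alpha>: "0 \<le> \<alpha>" "\<alpha> \<le> 1" and less: "separation_at \<mu> P0 (convex_mixtures \<mu> V) B \<alpha> < 1"
    using sep unfolding separation_def INF_less_iff by auto
  define \<rho> where "\<rho> = separation_at \<mu> P0 (convex_mixtures \<mu> V) B \<alpha>"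
  have \<rho>: "lr_transform \<mu> P0 P Q \<alpha> \<le> \<rho>" if "P \<in> convex_mixtures \<mu> V" "Q \<in> B" for P Q
    using that unfolding \<rho>_def separation_at_def by (intro SUP_upper2[of P] SUP_upper2[of Q]) auto
  show ?thesis
  proof (rule AE_tendsto_0_if_nn_integral_geometric)
    show "(\<integral>\<^sup>+x. posterior p prior n x V \<partial>S)
      \<le> powr0 \<alpha> (inverse (emeasure prior B)) * powr0 \<alpha> (emeasure prior V) * \<rho> ^ n" for n
      by (intro nn_integral_posterior_le \<alpha> \<rho> V B B_pos)
    have "inverse (emeasure prior B) < \<top>" "emeasure prior V < \<top>"
      using B_pos by (auto simp: less_top[symmetric])
    then show "powr0 \<alpha> (inverse (emeasure prior B)) * powr0 \<alpha> (emeasure prior V) < \<top>"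
      by (simp add: ennreal_mult_less_top powr0_less_top)
    show "\<rho> < 1" using less by (simp add: \<rho>_def)
  qed (rule measurable_posterior[OF V])
qed

end

text \<open>A \<mu>-null set is null under every model measure, hence under the prior predictive of
  one observation, hence under \<open>P0\<close>.\<close>

lemma (in dominated_model) absolutely_continuous_if_prior_predictive:
  assumes "prob_space P0" and sets_P0: "sets P0 = sets \<mu>"
    and ac: "absolutely_continuous (prior_predictive \<mu> prior 1) (\<Pi>\<^sub>M i\<in>{..<1}. P0)"
  shows "absolutely_continuous \<mu> P0"
  unfolding absolutely_continuous_def
proof
  interpret P0: prob_space P0 by fact
  \<comment> \<open>Identifies the one-fold product with \<open>P\<close> itself, sets
    \<open>A\<close> corresponding to functions on \<open>{..<1}\<close> with value in
    \<open>A\<close>.\<close>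
  have PiM: "emeasure (\<Pi>\<^sub>M i\<in>{..<1::nat}. P) (\<Pi>\<^sub>E i\<in>{..<1}. A) = emeasure P A"
    if "prob_space P" "A \<in> sets P" for P :: "'a measure" and A
  proof -
    interpret prob_space P by fact
    interpret product_sigma_finite "\<lambda>_::nat. P" ..
    show ?thesis using that by (subst emeasure_PiM) auto
  qed
  fix A assume A: "A \<in> null_sets \<mu>"
  let ?C = "\<Pi>\<^sub>E i\<in>{..<1::nat}. A"
  have C: "?C \<in> sets (\<Pi>\<^sub>M i\<in>{..<1}. \<mu>)" using A by (intro sets_PiM_I_finite) auto
  have "emeasure (prior_predictive \<mu> prior 1) ?C = (\<integral>\<^sup>+P. 0 \<partial>prior)"
    unfolding emeasure_prior_predictive[OF C]
  proof (rule nn_integral_cong)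
    fix P assume "P \<in> space prior"
    then have P: "P \<in> \<P>" by (simp add: space_prior)
    have "A \<in> null_sets (density \<mu> (p P))"
      using A measurable_density_model[OF P] AE_not_in[OF A] by (intro null_sets_density_iff[THEN iffD2]) (auto elim!: eventually_mono)
    then show "emeasure (\<Pi>\<^sub>M i\<in>{..<1}. P) ?C = 0"
      using A P by (subst PiM) (auto simp: prob_space_model sets_model density_model)
  qed
  then have "?C \<in> null_sets (prior_predictive \<mu> prior 1)"
    using C by (auto simp: null_sets_def sets_prior_predictive)
  then have "?C \<in> null_sets (\<Pi>\<^sub>M i\<in>{..<1}. P0)"
    using ac by (auto simp: absolutely_continuous_def)
  then show "A \<in> null_sets P0"
    using A sets_P0 PiM[OF assms(1), of A] by (auto simp: null_sets_def)
qed

theorem theorem1p6: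
  fixes \<mu> P0 :: "'a measure"
    and \<P> :: "'a measure set"
    and prior :: "'a measure measure"
    and p :: "'a measure \<Rightarrow> 'a \<Rightarrow> ennreal"
    and N :: nat
    and V B :: "nat \<Rightarrow> 'a measure set"
    and U :: "'a measure set"
  assumes "dominated_model \<mu> \<P> prior p"
    and "prob_space P0" and "sets P0 = sets \<mu>"
    and "\<And>n. n \<ge> 1 \<Longrightarrow> absolutely_continuous (prior_predictive \<mu> prior n) (\<Pi>\<^sub>M i\<in>{..<n}. P0)"
    and "N \<ge> 1"
    and "\<And>i. i \<in> {1..N} \<Longrightarrow> V i \<in> sets prior"
    and "\<And>i. i \<in> {1..N} \<Longrightarrow> B i \<in> sets prior"
    and "\<And>i. i \<in> {1..N} \<Longrightarrow> separation \<mu> P0 (convex_mixtures \<mu> (V i)) (B i) < 1"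
    and "\<And>i. i \<in> {1..N} \<Longrightarrow> measure prior (B i) > 0"
    and "\<And>i P. i \<in> {1..N} \<Longrightarrow> P \<in> V i \<Longrightarrow> (SUP Q\<in>B i. lr_transform \<mu> P0 P Q 1) < \<infinity>"
    and "U \<in> sets prior" and "U \<subseteq> (\<Union>i\<in>{1..N}. V i)"
  shows "AE x in (\<Pi>\<^sub>M i\<in>(UNIV :: nat set). P0). (\<lambda>n. posterior p prior n x U) \<longlonglongrightarrow> 0"
proof -
  interpret dominated_model \<mu> \<P> prior p by fact
  interpret dominated_sample \<mu> \<P> prior p P0
    using assms(2-4) absolutely_continuous_if_prior_predictive
    by (intro dominated_sample.intro dominated_sample_axioms.intro dominated_model_axioms) auto
  have "AE x in S. (\<lambda>n. posterior p prior n x (V i)) \<longlonglongrightarrow> 0" if "i \<in> {1..N}" for i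
    using assms(6-9)[OF that] by (intro AE_posterior_tendsto_0) (auto simp: measure_def)
  \<comment> \<open>Finitely many exceptional null sets are united. Off their union the posterior of
    \<open>U\<close> is squeezed between 0 and a finite sum tending to 0.\<close>
  then have "AE x in S. \<forall>i\<in>{1..N}. (\<lambda>n. posterior p prior n x (V i)) \<longlonglongrightarrow> 0"
    by (intro AE_finite_allI) auto
  then show ?thesis
    using AE_space
  proof eventually_elim
    case (elim x)
    show ?case
    proof (rule tendsto_sandwich[OF _ _ tendsto_const])
      show "\<forall>\<^sub>F n in sequentially. posterior p prior n x U \<le> (\<Sum>i\<in>{1..N}. posterior p prior n x (V i))"
        using elim(2) assms(6,12)
        by (intro always_eventually allI posterior_subadditive measurable_likelihood_prior) auto
      show "(\<lambda>n. \<Sum>i\<in>{1..N}. posterior p prior n x (V i)) \<longlonglongrightarrow> 0"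
        using tendsto_sum[of "{1..N}" "\<lambda>i n. posterior p prior n x (V i)" "\<lambda>_. 0"] elim(1) by auto
    qed auto
  qed
qed

end
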